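(* There is an $\omega$-bounded Type I surface $S$ such that $\langle\mathfrak{D}_S,\preceq\rangle$ is order-isomorphic to $\langle K,\le\rangle$, where $K$ is the Cantor set embedded in the interval $[0,1]$ with the induced order.
   Context: All spaces are Hausdorff and all functions are continuous unless otherwise specified. A space $X$ is Type I if $X=\bigcup_{\alpha<\omega_1}X_\alpha$ with each $X_\alpha$ open, $\overline{X_\alpha}$ Lindelöf, and $\overline{X_\alpha}\subset X_\beta$ whenever $\alpha<\beta$; Type I spaces are always assumed non-Lindelöf. A subset of a Type I space is bounded if it is contained in some $X_\alpha$, otherwise unbounded; a function into a Type I space is (un)bounded if its range is. Club means closed and unbounded. $\mathbb{L}_{\ge 0}$ is the closed long ray $\omega_1\times[0,1)$ with the lexicographic order topology (with $X_\alpha=[0,\alpha)$). For subsets $A,B$ of a Type I space $X$, write $A\preceq B$ if for every continuous $f:X\to\mathbb{L}_{\ge 0}$, $f|_A$ unbounded implies $f|_B$ unbounded; $A,B$ are ufo-equivalent if $A\preceq B\preceq A$. A direction in $X$ is a club $D\subset X$ which is ufo-equivalent to each of its club subsets. $\langle\mathfrak{D}_X,\preceq\rangle$ is the poset of ufo-equivalence classes of directions in $X$. A space is $\omega$-bounded if the closure of every countable subset is compact. A surface is a 2-dimensional manifold, with or without boundary (connected, Hausdorff). *)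

theory Defs
  imports "HOL-Analysis.Analysis"
begin

section \<open>The first uncountable ordinal\<close>

text \<open>\<open>cardSuc natLeq\<close> is the initial well-order of the successor cardinal of
  \<open>\<aleph>\<^sub>0\<close>, so the type below, with the inherited order, is \<open>\<omega>\<^sub>1\<close>.\<close>

typedef omega1 = "Field (cardSuc natLeq)"
proof -
  have "\<not> finite (Field (cardSuc natLeq))"
    using cardSuc_finite[OF natLeq_Card_order] Field_natLeq by simp
  then show ?thesis
    by (metis ex_in_conv finite.emptyI)
qed

instantiation omega1 :: wellorder
begin

definition less_eq_omega1 :: "omega1 \<Rightarrow> omega1 \<Rightarrow> bool" where
  "a \<le> b \<longleftrightarrow> (Rep_omega1 a, Rep_omega1 b) \<in> cardSuc natLeq"

definition less_omega1 :: "omega1 \<Rightarrow> omega1 \<Rightarrow> bool" where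
  "a < b \<longleftrightarrow> a \<le> b \<and> \<not> b \<le> (a :: omega1)"

instance
proof -
  have wo: "Well_order (cardSuc natLeq)"
    by (simp add: cardSuc_Card_order natLeq_Card_order card_order_on_well_order_on)
  then have R: "Refl (cardSuc natLeq)" and T: "trans (cardSuc natLeq)"
    and A: "antisym (cardSuc natLeq)" and L: "Total (cardSuc natLeq)"
    and W: "wf (cardSuc natLeq - Id)"
    by (auto simp: order_on_defs)
  have refl: "a \<le> a" for a :: omega1
    using R Rep_omega1[of a] by (auto simp: less_eq_omega1_def refl_on_def)
  have anti: "a = b" if "a \<le> b" "b \<le> a" for a b :: omega1
    using that A by (auto simp: less_eq_omega1_def Rep_omega1_inject dest: antisymD)
  have less_iff: "(Rep_omega1 a, Rep_omega1 b) \<in> cardSuc natLeq - Id \<longleftrightarrow> a < b" for a b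
    using anti[of a b] refl[of a]
    by (auto simp: less_omega1_def less_eq_omega1_def Rep_omega1_inject)
  have "wf (inv_image (cardSuc natLeq - Id) Rep_omega1)"
    using W by (rule wf_inv_image)
  then have wf_less: "wf {(a, b :: omega1). a < b}"
    by (simp only: inv_image_def less_iff)
  show "OFCLASS(omega1, wellorder_class)"
  proof
    fix x y z :: omega1
    show "x < y \<longleftrightarrow> x \<le> y \<and> \<not> y \<le> x" by (rule less_omega1_def)
    show "x \<le> x" by (rule refl)
    show "x \<le> z" if "x \<le> y" "y \<le> z"
      using that T unfolding less_eq_omega1_def by (rule transD[rotated])
    show "x = y" if "x \<le> y" "y \<le> x" using that by (rule anti)
    show "x \<le> y \<or> y \<le> x"
      using L refl[of x] Rep_omega1[of x] Rep_omega1[of y]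
      by (cases "x = y") (auto simp: less_eq_omega1_def total_on_def Rep_omega1_inject)
  next
    fix P :: "omega1 \<Rightarrow> bool" and a
    assume "\<And>x. (\<And>y. y < x \<Longrightarrow> P y) \<Longrightarrow> P x"
    then show "P a" using wf_induct[OF wf_less, of P a] by blast
  qed
qed

end


section \<open>The closed long ray\<close>

typedef long_ray = "(UNIV :: omega1 set) \<times> {0..<1 :: real}"
  by (rule exI[of _ "(undefined, 0)"]) simp

definition lr_point :: "omega1 \<Rightarrow> long_ray" where
  "lr_point \<alpha> = Abs_long_ray (\<alpha>, 0)"

instantiation long_ray :: linorder
begin

definition less_long_ray :: "long_ray \<Rightarrow> long_ray \<Rightarrow> bool" where
  "x < y \<longleftrightarrow> fst (Rep_long_ray x) < fst (Rep_long_ray y) \<or>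
     fst (Rep_long_ray x) = fst (Rep_long_ray y) \<and> snd (Rep_long_ray x) < snd (Rep_long_ray y)"

definition less_eq_long_ray :: "long_ray \<Rightarrow> long_ray \<Rightarrow> bool" where
  "x \<le> y \<longleftrightarrow> x < y \<or> x = (y :: long_ray)"

instance
proof
  fix x y z :: long_ray
  show "x < y \<longleftrightarrow> x \<le> y \<and> \<not> y \<le> x" "x \<le> x"
    by (auto simp: less_long_ray_def less_eq_long_ray_def)
  show "x \<le> z" if "x \<le> y" "y \<le> z"
    using that by (auto simp: less_long_ray_def less_eq_long_ray_def)
  show "x = y" if "x \<le> y" "y \<le> x"
    using that by (auto simp: less_long_ray_def less_eq_long_ray_def)
  show "x \<le> y \<or> y \<le> x"
    by (auto simp: less_long_ray_def less_eq_long_ray_def Rep_long_ray_inject[symmetric] prod_eq_iff)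
qed

end

instantiation long_ray :: linorder_topology
begin

definition open_long_ray :: "long_ray set \<Rightarrow> bool" where
  "open_long_ray = generate_topology (range (\<lambda>a. {..<a}) \<union> range (\<lambda>a. {a<..}))"

instance
  by standard (rule open_long_ray_def)

end


section \<open>Type I spaces and bounded sets\<close>

text \<open>A Type I space is given together with its exhaustion \<open>(X\<^sub>\<alpha>)\<close>, here
  \<open>U\<close>. Any two such exhaustions of a space have the same bounded sets: each
  \<open>closure X\<^sub>\<alpha>\<close> is Lindelof, hence covered by countably many members of the other
  exhaustion, hence contained in a single one.\<close>

definition type_I_space :: "'a topology \<Rightarrow> (omega1 \<Rightarrow> 'a set) \<Rightarrow> bool" where
  "type_I_space X U \<longleftrightarrow>
     Hausdorff_space X \<and>
     topspace X = (\<Union>\<alpha>. U \<alpha>) \<and>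
     (\<forall>\<alpha>. openin X (U \<alpha>)) \<and>
     (\<forall>\<alpha>. Lindelof_space (subtopology X (X closure_of U \<alpha>))) \<and>
     (\<forall>\<alpha> \<beta>. \<alpha> < \<beta> \<longrightarrow> X closure_of U \<alpha> \<subseteq> U \<beta>) \<and>
     \<not> Lindelof_space X"

definition unbounded_wrt :: "(omega1 \<Rightarrow> 'a set) \<Rightarrow> 'a set \<Rightarrow> bool" where
  "unbounded_wrt U A \<longleftrightarrow> \<not> (\<exists>\<alpha>. A \<subseteq> U \<alpha>)"

definition lr_exhaustion :: "omega1 \<Rightarrow> long_ray set" where
  "lr_exhaustion \<alpha> = {..<lr_point \<alpha>}"

definition club :: "'a topology \<Rightarrow> (omega1 \<Rightarrow> 'a set) \<Rightarrow> 'a set \<Rightarrow> bool" where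
  "club X U C \<longleftrightarrow> closedin X C \<and> unbounded_wrt U C"


section \<open>Directions\<close>

definition ufo_le :: "'a topology \<Rightarrow> 'a set \<Rightarrow> 'a set \<Rightarrow> bool" where
  "ufo_le X A B \<longleftrightarrow>
     (\<forall>f :: 'a \<Rightarrow> long_ray. continuous_map X euclidean f \<longrightarrow>
        unbounded_wrt lr_exhaustion (f ` A) \<longrightarrow> unbounded_wrt lr_exhaustion (f ` B))"

definition ufo_equiv :: "'a topology \<Rightarrow> 'a set \<Rightarrow> 'a set \<Rightarrow> bool" where
  "ufo_equiv X A B \<longleftrightarrow> ufo_le X A B \<and> ufo_le X B A"

definition direction :: "'a topology \<Rightarrow> (omega1 \<Rightarrow> 'a set) \<Rightarrow> 'a set \<Rightarrow> bool" where
  "direction X U D \<longleftrightarrow> club X U D \<and> (\<forall>C. C \<subseteq> D \<and> club X U C \<longrightarrow> ufo_equiv X D C)"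

definition direction_classes :: "'a topology \<Rightarrow> (omega1 \<Rightarrow> 'a set) \<Rightarrow> 'a set set set" where
  "direction_classes X U =
     {D. direction X U D} // {(A, B). direction X U A \<and> direction X U B \<and> ufo_equiv X A B}"

definition class_le :: "'a topology \<Rightarrow> 'a set set \<Rightarrow> 'a set set \<Rightarrow> bool" where
  "class_le X \<A> \<B> \<longleftrightarrow> (\<exists>A\<in>\<A>. \<exists>B\<in>\<B>. ufo_le X A B)"


section \<open>\<open>\<omega>\<close>-bounded surfaces\<close>

definition omega_bounded :: "'a topology \<Rightarrow> bool" where
  "omega_bounded X \<longleftrightarrow>
     (\<forall>C. C \<subseteq> topspace X \<and> countable C \<longrightarrow> compactin X (X closure_of C))"

text \<open>Local model: open subsets of the closed half plane, so that points with and without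
  boundary charts are covered. Second countability is not required.\<close>

definition surface :: "'a topology \<Rightarrow> bool" where
  "surface X \<longleftrightarrow>
     Hausdorff_space X \<and> connected_space X \<and>
     (\<forall>x\<in>topspace X. \<exists>V W. openin X V \<and> x \<in> V \<and>
        openin (top_of_set {p :: real \<times> real. 0 \<le> snd p}) W \<and>
        subtopology X V homeomorphic_space top_of_set W)"


section \<open>The Cantor set\<close>

fun cantor_stage :: "nat \<Rightarrow> real set" where
  "cantor_stage 0 = {0..1}"
| "cantor_stage (Suc n) =
     (\<lambda>x. x / 3) ` cantor_stage n \<union> (\<lambda>x. (x + 2) / 3) ` cantor_stage n"

definition cantor_set :: "real set" where
  "cantor_set = (\<Inter>n. cantor_stage n)"

end

theory Submission
  imports Defs "HOL-Library.Countable_Set_Type"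
begin

text \<open>Let \<open>K\<close> be the Cantor set. Over the long ray, take as fibre over \<open>x\<close> the set \<open>K\<close> with each of its
  gaps replaced by a copy of the interval \<open>[0, x]\<close>. Every fibre is an arc, and the union of the fibres
  below a fixed countable height is a triangle, so the result is a surface. It is the union of octants
  \<open>{(x, y). y \<le> x}\<close>, one for each gap, and of a line for each point \<open>k\<close> of \<open>K\<close>. If a continuous
  function to the long ray is unbounded on the line at \<open>k\<close>, it is so on the line at every \<open>k' \<ge> k\<close>:
  the set of such parameters is clopen in \<open>K\<close>, and unboundedness passes from the horizontal side of
  an octant to its diagonal. On the other hand the coordinate in a gap is unbounded exactly to the
  right of it. A club set is therefore determined up to the preorder by the set of gap coordinates that
  are unbounded on it, which is an initial segment of the gaps, that is, a point of \<open>K\<close>.\<close>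

section \<open>Countable subsets of \<open>\<omega>\<^sub>1\<close>\<close>

text \<open>All unboundedness arguments rest on one device. Heights and the values of countably many
  functions are squeezed between consecutive terms of an increasing \<omega>-sequence in the long
  ray; this sequence converges, and at the limit all the functions equal the height. It shows that
  the set of parameters with unbounded lines is closed; its complement is closed because countably
  many bounds have a common bound. As \<open>K\<close> is not connected, a clopen set alone cannot
  propagate unboundedness: compactness reduces the question to the two ends of one gap, and there
  the octant takes over.

  Coding a point by its countably many gap coordinates turns the glued surface into a closed subset
  of a countable product of long rays, so that parts of bounded height are compact and the gap
  coordinates are continuous by construction. The price is paid in the charts: a real parameter
  exists only on a countable initial segment of the long ray, and the position in a fibre has to be
  measured by a weighted sum of coordinates, with weights adding up to 1.\<close>

lemma uncountable_omega1: "uncountable (UNIV :: omega1 set)"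
proof
  assume "countable (UNIV :: omega1 set)"
  then have "countable (Rep_omega1 ` UNIV)"
    by (rule countable_image)
  then have "countable (Field (cardSuc natLeq))"
    by (simp add: type_definition.Rep_range[OF type_definition_omega1])
  then have "ordLeq3 (card_of (Field (cardSuc natLeq))) natLeq"
    by (simp add: countable_card_le_natLeq)
  then have "ordLeq3 (cardSuc natLeq) natLeq"
    using card_of_Field_ordIso[OF cardSuc_Card_order[OF natLeq_Card_order]]
      ordIso_ordLeq_trans ordIso_symmetric by blast
  then show False
    using cardSuc_greater[OF natLeq_Card_order] not_ordLess_ordLeq by blast
qed

lemma countable_lessThan_omega1: "countable {..<a :: omega1}"
proof -
  have "Rep_omega1 ` {..<a} \<subseteq> underS (cardSuc natLeq) (Rep_omega1 a)"
    by (auto simp: underS_def less_le less_eq_omega1_def Rep_omega1_inject)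
  moreover have "ordLess2 (card_of (underS (cardSuc natLeq) (Rep_omega1 a))) (cardSuc natLeq)"
    by (rule card_of_underS[OF cardSuc_Card_order[OF natLeq_Card_order] Rep_omega1])
  then have "countable (underS (cardSuc natLeq) (Rep_omega1 a))"
    by (simp add: countable_card_le_natLeq cardSuc_ordLeq_ordLess natLeq_Card_order card_of_Card_order)
  ultimately have "countable (Rep_omega1 ` {..<a})"
    by (rule countable_subset)
  then show ?thesis
    by (rule countable_image_inj_on) (auto simp: inj_on_def Rep_omega1_inject)
qed

lemma countable_omega1_bounded:
  assumes "countable A"
  shows "\<exists>b :: omega1. \<forall>a\<in>A. a < b"
proof (rule ccontr)
  assume "\<nexists>b. \<forall>a\<in>A. a < b"
  then have "UNIV = (\<Union>a\<in>A. insert a {..<a})"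
    by (force simp: not_less le_less)
  moreover have "countable (\<Union>a\<in>A. insert a {..<a})"
    using assms by (intro countable_UN) (auto intro: countable_lessThan_omega1)
  ultimately show False
    using uncountable_omega1 by simp
qed

section \<open>Order intervals of the long ray\<close>

text \<open>Lay segments of length \<open>\<mu> n\<close> end to end in the order of
  \<open>g\<close>. That order need not be discrete, so \<open>y\<close> may lie in no segment and
  merely cut the family into a lower and an upper part. Finite subsets of each part are controlled
  by their \<open>g\<close>-extreme member, which yields both inequalities for
  \<open>infsum \<mu> D\<close>. It serves for surjectivity twice: of the real chart of a countable
  ordinal, and of the chart on the fibres of the surface.\<close>

lemma infsum_cut:
  fixes \<mu> :: "'i \<Rightarrow> real" and g :: "'i \<Rightarrow> 'k :: linorder"
  assumes inj: "inj_on g A" and sm: "\<mu> summable_on A" and nn: "\<And>n. n \<in> A \<Longrightarrow> 0 \<le> \<mu> n"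
    and y: "0 \<le> y" "y \<le> infsum \<mu> A"
  defines "lo \<equiv> \<lambda>n. infsum \<mu> {m \<in> A. g m < g n}"
  shows "(\<exists>n\<in>A. lo n \<le> y \<and> y < lo n + \<mu> n) \<or>
    (\<exists>D\<subseteq>A. infsum \<mu> D = y \<and> (\<forall>n\<in>D. \<forall>m\<in>A. g m < g n \<longrightarrow> m \<in> D))"
proof (cases "\<exists>n\<in>A. lo n \<le> y \<and> y < lo n + \<mu> n")
  case False
  define D where "D = {n \<in> A. lo n + \<mu> n \<le> y}"
  have sub: "\<mu> summable_on B" if "B \<subseteq> A" for B
    using summable_on_subset_banach[OF sm that] .
  have mono: "infsum \<mu> B \<le> infsum \<mu> C" if "B \<subseteq> C" "C \<subseteq> A" for B C
    using that nn by (intro infsum_mono2 sub) auto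
  have hi: "infsum \<mu> {m \<in> A. g m \<le> g n} = lo n + \<mu> n" if "n \<in> A" for n
  proof -
    have "{m \<in> A. g m \<le> g n} = {m \<in> A. g m < g n} \<union> {n}"
      using inj that by (auto simp: le_less inj_on_def)
    then show ?thesis
      using infsum_Un_disjoint[of \<mu> "{m \<in> A. g m < g n}" "{n}"] that
      unfolding lo_def by (simp add: sub)
  qed
  have upper: "infsum \<mu> {m \<in> A. g n \<le> g m} = infsum \<mu> A - lo n" for n
  proof -
    have "A = {m \<in> A. g m < g n} \<union> {m \<in> A. g n \<le> g m}"
      by auto
    then have "infsum \<mu> A = infsum \<mu> ({m \<in> A. g m < g n} \<union> {m \<in> A. g n \<le> g m})"
      by simp
    also have "\<dots> = lo n + infsum \<mu> {m \<in> A. g n \<le> g m}"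
      unfolding lo_def by (rule infsum_Un_disjoint) (auto intro: sub)
    finally show ?thesis by simp
  qed
  have le: "infsum \<mu> D \<le> y"
  proof (rule infsum_le_finite_sums)
    show "\<mu> summable_on D" by (rule sub) (auto simp: D_def)
    fix F assume F: "finite F" "F \<subseteq> D"
    show "sum \<mu> F \<le> y"
    proof (cases "F = {}")
      case False
      then have "Max (g ` F) \<in> g ` F" using F by simp
      then obtain n where n: "n \<in> F" "g n = Max (g ` F)" by auto
      then have "F \<subseteq> {m \<in> A. g m \<le> g n}" using F by (auto simp: D_def)
      then have "infsum \<mu> F \<le> lo n + \<mu> n"
        using mono[of F "{m \<in> A. g m \<le> g n}"] hi[of n] n F by (auto simp: D_def)
      also have "\<dots> \<le> y" using n F by (auto simp: D_def)
      finally show ?thesis using F by simp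
    qed (use y in simp)
  qed
  \<comment> \<open>A segment outside \<open>D\<close> ends after \<open>y\<close> and does not
    contain \<open>y\<close>, so it starts after \<open>y\<close>, and so does the whole tail from
    the least member of \<open>F\<close> on.\<close>
  have ge: "infsum \<mu> (A - D) \<le> infsum \<mu> A - y"
  proof (rule infsum_le_finite_sums)
    show "\<mu> summable_on (A - D)" by (rule sub) auto
    fix F assume F: "finite F" "F \<subseteq> A - D"
    show "sum \<mu> F \<le> infsum \<mu> A - y"
    proof (cases "F = {}")
      case nonempty: False
      then have "Min (g ` F) \<in> g ` F" using F by simp
      then obtain n where n: "n \<in> F" "g n = Min (g ` F)" by auto
      then have "F \<subseteq> {m \<in> A. g n \<le> g m}" using F by auto
      then have "infsum \<mu> F \<le> infsum \<mu> A - lo n"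
        using mono[of F "{m \<in> A. g n \<le> g m}"] upper[of n] n F by auto
      also have "\<dots> \<le> infsum \<mu> A - y" using n F False by (force simp: D_def)
      finally show ?thesis using F by simp
    qed (use y in simp)
  qed
  have "infsum \<mu> A = infsum \<mu> (D \<union> (A - D))"
    by (rule arg_cong[of _ _ "infsum \<mu>"]) (auto simp: D_def)
  also have "\<dots> = infsum \<mu> D + infsum \<mu> (A - D)"
    by (rule infsum_Un_disjoint) (auto intro!: sub simp: D_def)
  finally have "infsum \<mu> D = y" using le ge by simp
  moreover have "m \<in> D" if "n \<in> D" "m \<in> A" "g m < g n" for n m
  proof -
    have "infsum \<mu> {l \<in> A. g l \<le> g m} \<le> infsum \<mu> {l \<in> A. g l \<le> g n}"
      using that by (intro mono) auto
    then show ?thesis using that hi[of m] hi[of n] by (simp add: D_def)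
  qed
  moreover have "D \<subseteq> A" by (auto simp: D_def)
  ultimately show ?thesis by blast
qed simp

abbreviation lr_make :: "omega1 \<Rightarrow> real \<Rightarrow> long_ray" where
  "lr_make \<beta> r \<equiv> Abs_long_ray (\<beta>, r)"

lemma Rep_lr_make: "0 \<le> r \<Longrightarrow> r < 1 \<Longrightarrow> Rep_long_ray (lr_make \<beta> r) = (\<beta>, r)"
  by (simp add: Abs_long_ray_inverse)

lemma long_ray_cases:
  obtains \<beta> r where "x = lr_make \<beta> r" "0 \<le> r" "r < 1"
  by (cases x) auto

lemma lr_make_less_iff:
  assumes "0 \<le> r" "r < 1" "0 \<le> s" "s < 1"
  shows "lr_make \<beta> r < lr_make \<gamma> s \<longleftrightarrow> \<beta> < \<gamma> \<or> \<beta> = \<gamma> \<and> r < s"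
  using assms by (simp add: less_long_ray_def Rep_lr_make)

text \<open>Below \<alpha> there are only countably many unit intervals; giving them summable
  lengths and stacking them in order embeds the segment into the reals.\<close>

lemma ex_initial_segment_iso:
  obtains e :: "long_ray \<Rightarrow> real" and T where
    "strict_mono_on {..<lr_point \<alpha>} e" "e ` {..<lr_point \<alpha>} = {0..<T}"
proof
  define \<mu> :: "omega1 \<Rightarrow> real" where "\<mu> \<beta> = (1/2) ^ to_nat_on {..<\<alpha>} \<beta>" for \<beta>
  have "(\<lambda>n. (1/2::real) ^ n) summable_on UNIV"
    by (intro norm_summable_imp_summable_on) (simp add: summable_geometric)
  then have "(\<lambda>n. (1/2::real) ^ n) summable_on to_nat_on {..<\<alpha>} ` {..<\<alpha>}"
    by (rule summable_on_subset_banach) simp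
  then have sm: "\<mu> summable_on {..<\<alpha>}"
    unfolding summable_on_reindex[OF inj_on_to_nat_on[OF countable_lessThan_omega1[of \<alpha>]]]
    by (simp add: \<mu>_def[abs_def] o_def)
  have pos: "\<mu> \<beta> > 0" for \<beta> by (simp add: \<mu>_def)
  define lo where "lo \<beta> = infsum \<mu> {..<\<beta>}" for \<beta>
  define T where "T = lo \<alpha>"
  have step: "lo \<beta> + \<mu> \<beta> \<le> lo \<gamma>" if "\<beta> < \<gamma>" "\<gamma> \<le> \<alpha>" for \<beta> \<gamma>
  proof -
    have s: "\<mu> summable_on B" if "B \<subseteq> {..<\<alpha>}" for B
      using summable_on_subset_banach[OF sm that] .
    have "lo \<beta> + \<mu> \<beta> = infsum \<mu> ({..<\<beta>} \<union> {\<beta>})"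
      unfolding lo_def using that by (subst infsum_Un_disjoint) (auto intro!: s)
    also have "\<dots> \<le> lo \<gamma>"
      unfolding lo_def using that pos by (intro infsum_mono2 s) (auto intro: less_imp_le)
    finally show ?thesis .
  qed
  have lo_nonneg: "0 \<le> lo \<beta>" for \<beta>
    unfolding lo_def by (intro infsum_nonneg) (simp add: pos less_imp_le)
  define e where "e x = lo (fst (Rep_long_ray x)) + snd (Rep_long_ray x) * \<mu> (fst (Rep_long_ray x))" for x
  have e_make: "e (lr_make \<beta> r) = lo \<beta> + r * \<mu> \<beta>" if "0 \<le> r" "r < 1" for \<beta> r
    using that by (simp add: e_def Rep_lr_make)
  have mem: "lr_make \<beta> r \<in> {..<lr_point \<alpha>} \<longleftrightarrow> \<beta> < \<alpha>" if "0 \<le> r" "r < 1" for \<beta> r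
    using that by (simp add: lr_point_def lr_make_less_iff)
  have below: "e (lr_make \<beta> r) < lo \<beta> + \<mu> \<beta>" if "0 \<le> r" "r < 1" for \<beta> r
    using that pos[of \<beta>] by (simp add: e_make)
  show "strict_mono_on {..<lr_point \<alpha>} e"
  proof (rule strict_mono_onI)
    fix x y assume xy: "x \<in> {..<lr_point \<alpha>}" "y \<in> {..<lr_point \<alpha>}" "x < y"
    obtain \<beta> r where x: "x = lr_make \<beta> r" "0 \<le> r" "r < 1" by (rule long_ray_cases)
    obtain \<gamma> s where y: "y = lr_make \<gamma> s" "0 \<le> s" "s < 1" by (rule long_ray_cases)
    have "\<beta> < \<alpha>" "\<gamma> < \<alpha>" using xy x y by (simp_all only: mem)
    from xy(3) have "\<beta> < \<gamma> \<or> \<beta> = \<gamma> \<and> r < s" using x y by (simp add: lr_make_less_iff)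
    then show "e x < e y"
    proof
      assume "\<beta> < \<gamma>"
      then have "e x < lo \<gamma>" using below[of r \<beta>] step[of \<beta> \<gamma>] x \<open>\<gamma> < \<alpha>\<close> by (simp add: less_imp_le)
      also have "\<dots> \<le> e y" using y pos[of \<gamma>] by (simp add: e_make)
      finally show ?thesis .
    qed (use x y pos in \<open>simp add: e_make\<close>)
  qed
  show "e ` {..<lr_point \<alpha>} = {0..<T}"
  proof (intro equalityI subsetI)
    fix v assume "v \<in> e ` {..<lr_point \<alpha>}"
    then obtain \<beta> r where b: "v = e (lr_make \<beta> r)" "0 \<le> r" "r < 1" "\<beta> < \<alpha>"
      using mem by (metis imageE long_ray_cases)
    then have "v < T" using below[of r \<beta>] step[of \<beta> \<alpha>] by (simp add: T_def)
    moreover have "0 \<le> v" using b lo_nonneg[of \<beta>] pos[of \<beta>] by (simp add: e_make)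
    ultimately show "v \<in> {0..<T}" by simp
  next
    fix v assume v: "v \<in> {0..<T}"
    have lo_eq: "infsum \<mu> {m. m < \<alpha> \<and> m < n} = lo n" if "n < \<alpha>" for n
      unfolding lo_def using that by (intro arg_cong[of _ _ "infsum \<mu>"]) auto
    \<comment> \<open>In the second case of \<open>infsum_cut\<close> the set \<open>D\<close> is a
      proper lower set of ordinals, hence \<open>{..<\<beta>}\<close> for the least ordinal \<beta>
      missing from it, and \<open>v\<close> is the left end of segment \<beta>. Well-ordering thus
      rules out a genuine cut.\<close>
    have "\<exists>n<\<alpha>. lo n \<le> v \<and> v < lo n + \<mu> n"
    proof (rule ccontr)
      assume no: "\<not> ?thesis"
      obtain D where D: "D \<subseteq> {..<\<alpha>}" and sumD: "infsum \<mu> D = v"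
        and down: "\<And>n m. n \<in> D \<Longrightarrow> m < \<alpha> \<Longrightarrow> m < n \<Longrightarrow> m \<in> D"
        using infsum_cut[of "\<lambda>n. n" "{..<\<alpha>}" \<mu> v] sm v no pos unfolding T_def lo_def[of \<alpha>]
        by (auto simp: less_imp_le lo_eq Ball_def)
      have ex: "\<exists>n. n < \<alpha> \<and> n \<notin> D"
      proof (rule ccontr)
        assume "\<not> ?thesis"
        then have "D = {..<\<alpha>}" using D by auto
        then show False using sumD v by (simp add: T_def lo_def)
      qed
      define \<beta> where "\<beta> = (LEAST n. n < \<alpha> \<and> n \<notin> D)"
      have \<beta>: "\<beta> < \<alpha>" "\<beta> \<notin> D"
        using LeastI_ex[OF ex] by (simp_all add: \<beta>_def)
      have "{..<\<beta>} \<subseteq> D"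
        using not_less_Least[of _ "\<lambda>n. n < \<alpha> \<and> n \<notin> D"] \<beta> unfolding \<beta>_def[symmetric]
        by force
      moreover have "n < \<beta>" if "n \<in> D" for n
      proof (rule ccontr)
        assume "\<not> n < \<beta>"
        then have "\<beta> < n" using that \<beta> by (metis less_linear)
        then show False using down[OF that \<beta>(1)] \<beta>(2) by simp
      qed
      ultimately have "D = {..<\<beta>}" by auto
      then have "lo \<beta> = v" using sumD by (simp add: lo_def)
      then show False using no \<beta>(1) pos[of \<beta>] by auto
    qed
    then obtain n where n: "n < \<alpha>" "lo n \<le> v" "v < lo n + \<mu> n" by blast
    define r where "r = (v - lo n) / \<mu> n"
    have r: "0 \<le> r" "r < 1" using n pos[of n] by (auto simp: r_def divide_simps)
    have "e (lr_make n r) = v" using r pos[of n] by (simp add: e_make r_def)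
    then show "v \<in> e ` {..<lr_point \<alpha>}" using n r mem[of r n] by blast
  qed
qed

text \<open>An order-convex image has no jumps: a bound \<open>b\<close> on one side of
  \<open>f x\<close> is either a value, whose argument bounds a neighbourhood of \<open>x\<close>,
  or no value at all lies on its far side.\<close>

lemma strict_mono_on_imp_continuous_on:
  fixes f :: "'a :: linorder_topology \<Rightarrow> 'b :: linorder_topology"
  assumes mono: "strict_mono_on A f"
    and conv: "\<And>u v w. u \<in> f ` A \<Longrightarrow> v \<in> f ` A \<Longrightarrow> u \<le> w \<Longrightarrow> w \<le> v \<Longrightarrow> w \<in> f ` A"
  shows "continuous_on A f"
  unfolding continuous_on_def
proof (intro ballI order_tendstoI)
  fix x b assume x: "x \<in> A" and b: "b < f x"
  show "\<forall>\<^sub>F y in at x within A. b < f y"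
  proof (cases "\<exists>a\<in>A. f a \<le> b")
    case True
    then obtain a where a: "a \<in> A" "f a = b"
      using conv[of _ "f x" b] x b by (auto simp: less_imp_le)
    then have "a < x" using b strict_mono_on_less[OF mono, of a x] x by simp
    then have "\<forall>\<^sub>F y in at x within A. a < y"
      by (rule order_tendstoD(1)[OF tendsto_ident_at])
    moreover have "\<forall>\<^sub>F y in at x within A. y \<in> A"
      by (auto simp: eventually_at_filter)
    ultimately show ?thesis
      by eventually_elim (use a mono in \<open>auto simp: strict_mono_on_def\<close>)
  next
    case False
    then show ?thesis by (auto simp: eventually_at_filter not_le)
  qed
next
  fix x b assume x: "x \<in> A" and b: "f x < b"
  show "\<forall>\<^sub>F y in at x within A. f y < b"
  proof (cases "\<exists>a\<in>A. b \<le> f a")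
    case True
    then obtain a where a: "a \<in> A" "f a = b"
      using conv[of "f x" _ b] x b by (auto simp: less_imp_le)
    then have "x < a" using b strict_mono_on_less[OF mono, of x a] x by simp
    then have "\<forall>\<^sub>F y in at x within A. y < a"
      by (rule order_tendstoD(2)[OF tendsto_ident_at])
    moreover have "\<forall>\<^sub>F y in at x within A. y \<in> A"
      by (auto simp: eventually_at_filter)
    ultimately show ?thesis
      by eventually_elim (use a mono in \<open>auto simp: strict_mono_on_def\<close>)
  next
    case False
    then show ?thesis by (auto simp: eventually_at_filter not_le)
  qed
qed

section \<open>Topology of the long ray\<close>

instantiation long_ray :: order_bot
begin

definition bot_long_ray :: long_ray where
  "bot_long_ray = lr_point (LEAST a. True)"

instance
proof
  fix x :: long_ray
  obtain \<beta> r where x: "x = lr_make \<beta> r" "0 \<le> r" "r < 1" by (rule long_ray_cases)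
  have "(LEAST a. True) \<le> \<beta>" by (rule Least_le) simp
  then show "bot \<le> x"
    using x by (auto simp: bot_long_ray_def lr_point_def lr_make_less_iff not_less[symmetric])
qed

end

lemma countable_long_ray_bounded:
  assumes "countable A"
  shows "\<exists>\<alpha>. \<forall>a\<in>A. a < lr_point \<alpha>"
proof -
  obtain \<alpha> where \<alpha>: "\<forall>a\<in>A. fst (Rep_long_ray a) < \<alpha>"
    using countable_omega1_bounded[of "(\<lambda>a. fst (Rep_long_ray a)) ` A"] assms by auto
  then have "a < lr_point \<alpha>" if "a \<in> A" for a
    using that by (auto simp: less_long_ray_def lr_point_def Rep_lr_make)
  then show ?thesis by blast
qed

lemma ex_lr_point_greater: "\<exists>\<alpha>. a < lr_point \<alpha>"
  using countable_long_ray_bounded[of "{a}"] by simp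

lemma initial_segment_homeomorphism:
  obtains e e' T where "strict_mono_on {..<lr_point \<alpha>} e"
    "homeomorphism {..<lr_point \<alpha>} {0..<T :: real} e e'"
proof -
  obtain e T where e: "strict_mono_on {..<lr_point \<alpha>} e" "e ` {..<lr_point \<alpha>} = {0..<T :: real}"
    by (rule ex_initial_segment_iso[of \<alpha>])
  define e' where "e' = inv_into {..<lr_point \<alpha>} e"
  have inj: "inj_on e {..<lr_point \<alpha>}" using e(1) by (rule strict_mono_on_imp_inj_on)
  have inv: "e' (e x) = x" if "x < lr_point \<alpha>" for x
    unfolding e'_def using that by (intro inv_into_f_f[OF inj]) simp
  have img: "e' ` {0..<T} = {..<lr_point \<alpha>}"
    unfolding e(2)[symmetric] image_image by (force simp: inv)
  have inv2: "e (e' t) = t" if "t \<in> {0..<T}" for t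
    unfolding e'_def using that e(2) by (metis f_inv_into_f)
  have mono': "strict_mono_on {0..<T} e'"
  proof (rule strict_mono_onI)
    fix s t assume st: "s \<in> {0..<T}" "t \<in> {0..<T}" "s < t"
    then have "e' s \<in> {..<lr_point \<alpha>}" "e' t \<in> {..<lr_point \<alpha>}" using img by blast+
    then show "e' s < e' t"
      using st strict_mono_on_less[OF e(1)] inv2 by metis
  qed
  have "continuous_on {..<lr_point \<alpha>} e"
    using e(1) by (rule strict_mono_on_imp_continuous_on) (auto simp: e(2))
  moreover have "continuous_on {0..<T} e'"
    using mono' by (rule strict_mono_on_imp_continuous_on) (auto simp: img)
  ultimately have "homeomorphism {..<lr_point \<alpha>} {0..<T} e e'"
    using e(2) img inv inv2 by (simp add: homeomorphism_def)
  with e(1) show thesis by (rule that)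
qed

text \<open>Rescaling the real chart by \<open>e a\<close> gives a closed interval, so compactness
  and connectedness are inherited from \<open>{0..1}\<close>. Later the path, starting at
  \<open>bot\<close>, parametrises the levels of a strip.\<close>

lemma atMost_long_ray_image:
  fixes a :: long_ray
  obtains c :: "real \<Rightarrow> long_ray" where "continuous_on {0..1} c" "c ` {0..1} = {..a}" "c 0 = bot"
proof -
  obtain \<alpha> where \<alpha>: "a < lr_point \<alpha>" using ex_lr_point_greater by blast
  obtain e e' T where e: "strict_mono_on {..<lr_point \<alpha>} e"
    "homeomorphism {..<lr_point \<alpha>} {0..<T :: real} e e'"
    by (rule initial_segment_homeomorphism[of \<alpha>])
  have h: "e' (e x) = x" "0 \<le> e x" "e x < T" if "x < lr_point \<alpha>" for x
    using e(2) that by (force simp: homeomorphism_def)+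
  have h': "e (e' t) = t" "e' t < lr_point \<alpha>" if "0 \<le> t" "t < T" for t
    using e(2) that by (force simp: homeomorphism_def)+
  have less: "x < y \<longleftrightarrow> e x < e y" if "x < lr_point \<alpha>" "y < lr_point \<alpha>" for x y
    using strict_mono_on_less[OF e(1)] that by simp
  have bot_less: "bot < lr_point \<alpha>" using \<alpha> by (rule le_less_trans[OF bot_least])
  then have "0 < T" using h(2,3)[of bot] by simp
  then have "\<not> bot < e' 0"
    using h(2)[OF bot_less] h'[of 0] less[of bot "e' 0"] bot_less by auto
  then have bot: "e' 0 = bot" using bot.not_eq_extremum by blast
  have rng: "0 \<le> t * e a \<and> t * e a \<le> e a \<and> t * e a < T" if "0 \<le> t" "t \<le> 1" for t
    using that h(2,3)[OF \<alpha>] mult_left_le_one_le[of "e a" t] by auto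
  show thesis
  proof
    have "continuous_on {0..<T} e'"
      using e(2) by (simp add: homeomorphism_def)
    then show "continuous_on {0..1} (\<lambda>t. e' (t * e a))"
      by (rule continuous_on_compose2) (use rng in \<open>auto intro!: continuous_on_mult_right\<close>)
    show "(\<lambda>t. e' (t * e a)) ` {0..1} = {..a}"
    proof (intro equalityI subsetI)
      fix x assume "x \<in> (\<lambda>t. e' (t * e a)) ` {0..1}"
      then obtain t where t: "x = e' (t * e a)" "0 \<le> t" "t \<le> 1" by auto
      then show "x \<in> {..a}"
        using rng[of t] h'[of "t * e a"] less[of a x] \<alpha> by (auto simp: not_less[symmetric])
    next
      fix x assume x: "x \<in> {..a}"
      then have xa: "x < lr_point \<alpha>" using \<alpha> by simp
      have le: "e x \<le> e a" using x less[OF \<alpha> xa] by (simp add: not_less[symmetric])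
      show "x \<in> (\<lambda>t. e' (t * e a)) ` {0..1}"
      proof (cases "e a = 0")
        case True
        then have "x = e' (0 * e a)" using le h[OF xa] by simp
        then show ?thesis by (rule image_eqI) simp
      next
        case False
        then have "x = e' (e x / e a * e a)" "0 \<le> e x / e a" "e x / e a \<le> 1"
          using le h[OF xa] h[OF \<alpha>] by (auto simp: divide_simps)
        then show ?thesis by (intro image_eqI[of _ _ "e x / e a"]) simp_all
      qed
    qed
  qed (simp add: bot)
qed

lemma compact_atMost_long_ray: "compact {..a :: long_ray}"
proof -
  obtain c :: "real \<Rightarrow> long_ray" where "continuous_on {0..1} c" "c ` {0..1} = {..a}" "c 0 = bot"
    by (rule atMost_long_ray_image[of a])
  then show ?thesis using compact_continuous_image[of "{0..1}" c] by simp
qed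

lemma connected_UNIV_long_ray: "connected (UNIV :: long_ray set)"
proof -
  have "connected {..a :: long_ray}" for a
  proof -
    obtain c :: "real \<Rightarrow> long_ray" where "continuous_on {0..1} c" "c ` {0..1} = {..a}" "c 0 = bot"
      by (rule atMost_long_ray_image[of a])
    then show ?thesis using connected_continuous_image[of "{0..1}" c] by simp
  qed
  then have "connected (\<Union>a :: long_ray. {..a})"
    by (intro connected_Union) (auto intro: bot_least)
  moreover have "(\<Union>a :: long_ray. {..a}) = UNIV" by auto
  ultimately show ?thesis by simp
qed

text \<open>Makes sequences sufficient in \<open>nat => long_ray\<close>: the limit arguments on the
  surface use sequential compactness and sequential closedness. The countable base is pulled back
  from the real chart.\<close>

instance long_ray :: first_countable_topology
proof
  fix x :: long_ray
  obtain \<alpha> where \<alpha>: "x < lr_point \<alpha>" using ex_lr_point_greater by blast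
  obtain e e' T where e: "strict_mono_on {..<lr_point \<alpha>} e"
    "homeomorphism {..<lr_point \<alpha>} {0..<T :: real} e e'"
    by (rule initial_segment_homeomorphism[of \<alpha>])
  have cont: "continuous_on {..<lr_point \<alpha>} e" "continuous_on {0..<T} e'"
    and h: "\<And>y. y < lr_point \<alpha> \<Longrightarrow> e' (e y) = y \<and> e y \<in> {0..<T}"
    using e(2) by (auto simp: homeomorphism_def)
  define A where "A i = {..<lr_point \<alpha>} \<inter> e -` ball (e x) (1 / Suc i)" for i :: nat
  show "\<exists>A :: nat \<Rightarrow> long_ray set. (\<forall>i. x \<in> A i \<and> open (A i)) \<and>
      (\<forall>S. open S \<and> x \<in> S \<longrightarrow> (\<exists>i. A i \<subseteq> S))"
  proof (intro exI[of _ A] conjI allI impI)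
    show "x \<in> A i" for i using \<alpha> by (simp add: A_def)
    show "open (A i)" for i
      unfolding A_def by (rule continuous_open_preimage[OF cont(1)]) auto
    fix S assume S: "open S \<and> x \<in> S"
    have "openin (top_of_set {0..<T}) ({0..<T} \<inter> e' -` S)"
      using cont(2) S by (simp add: continuous_openin_preimage_gen)
    then obtain d where d: "d > 0" "\<And>t. t \<in> {0..<T} \<Longrightarrow> dist t (e x) < d \<Longrightarrow> e' t \<in> S"
      using S h[OF \<alpha>] unfolding openin_euclidean_subtopology_iff by (auto simp: Ball_def)
    obtain i :: nat where "1 / real (Suc i) < d"
      using d(1) nat_approx_posE by blast
    have "A i \<subseteq> S"
    proof
      fix y assume y: "y \<in> A i"
      then have "dist (e y) (e x) < d" "y < lr_point \<alpha>"
        using \<open>1 / real (Suc i) < d\<close> by (auto simp: A_def dist_commute)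
      then show "y \<in> S" using d(2)[of "e y"] h[of y] by simp
    qed
    then show "\<exists>i. A i \<subseteq> S" by blast
  qed
qed

text \<open>A countable set is bounded, so the sequence stays in a compact segment, and monotonicity
  upgrades a convergent subsequence to the whole sequence.\<close>

lemma long_ray_increasing_converges:
  fixes X :: "nat \<Rightarrow> long_ray"
  assumes inc: "\<And>k. X k < X (Suc k)"
  obtains x where "X \<longlonglongrightarrow> x" "\<And>k. X k < x"
proof -
  have sm: "strict_mono X" using inc by (simp add: strict_mono_Suc_iff)
  obtain \<alpha> where \<alpha>: "\<And>k. X k < lr_point \<alpha>"
    using countable_long_ray_bounded[of "range X"] by auto
  then have "\<forall>k. X k \<in> {..lr_point \<alpha>}" by (simp add: less_imp_le)
  moreover have "seq_compact {..lr_point \<alpha>}"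
    by (rule compact_imp_seq_compact[OF compact_atMost_long_ray])
  ultimately obtain x r where r: "strict_mono (r :: nat \<Rightarrow> nat)" "(X \<circ> r) \<longlonglongrightarrow> x"
    unfolding seq_compact_def by metis
  have le: "X k \<le> x" for k
  proof (rule LIMSEQ_le_const[OF r(2)])
    show "\<exists>N. \<forall>n\<ge>N. X k \<le> (X \<circ> r) n"
    proof (intro exI allI impI)
      fix n assume "k \<le> n"
      then have "k \<le> r n" using seq_suble[OF r(1), of n] by simp
      then show "X k \<le> (X \<circ> r) n" using sm by (simp add: strict_mono_less_eq)
    qed
  qed
  then have lt: "X k < x" for k
    using inc[of k] less_le_trans by blast
  moreover have "X \<longlonglongrightarrow> x"
  proof (rule order_tendstoI)
    fix y assume "y < x"
    then obtain n where "y < X (r n)"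
      using order_tendstoD(1)[OF r(2)] by (auto simp: eventually_sequentially)
    then have "\<forall>k\<ge>r n. y < X k"
      using sm by (meson less_le_trans strict_mono_less_eq)
    then show "\<forall>\<^sub>F k in sequentially. y < X k"
      by (auto simp: eventually_sequentially)
  next
    fix y assume "x < y"
    then show "\<forall>\<^sub>F k in sequentially. X k < y"
      using lt by (auto intro: always_eventually less_trans)
  qed
  ultimately show thesis using that by blast
qed

lemma unbounded_lr_exhaustion_iff: "unbounded_wrt lr_exhaustion X \<longleftrightarrow> (\<forall>a. \<exists>x\<in>X. a < x)"
proof
  assume unb: "unbounded_wrt lr_exhaustion X"
  show "\<forall>a. \<exists>x\<in>X. a < x"
  proof
    fix a
    obtain \<alpha> where \<alpha>: "a < lr_point \<alpha>" using ex_lr_point_greater by blast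
    have "\<not> X \<subseteq> {..<lr_point \<alpha>}" using unb by (simp add: unbounded_wrt_def lr_exhaustion_def)
    then obtain x where "x \<in> X" "lr_point \<alpha> \<le> x" by (auto simp: subset_iff not_less)
    then show "\<exists>x\<in>X. a < x" using \<alpha> by (intro bexI[of _ x]) simp_all
  qed
next
  assume "\<forall>a. \<exists>x\<in>X. a < x"
  then have "\<not> X \<subseteq> {..<b}" for b
    by (metis lessThan_iff less_asym subsetD)
  then show "unbounded_wrt lr_exhaustion X"
    by (simp add: unbounded_wrt_def lr_exhaustion_def)
qed

text \<open>Meant for a \<open>P k x y\<close> that asserts the existence of witnesses strictly
  between \<open>x\<close> and \<open>y\<close>: every sequence of witnesses then has the same limit
  as \<open>X\<close>. The index \<open>k\<close> lets a stage be responsible for only the first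
  members of a family.\<close>

lemma long_ray_interleave:
  fixes P :: "nat \<Rightarrow> long_ray \<Rightarrow> long_ray \<Rightarrow> bool"
  assumes "\<And>k x. \<exists>y>x. P k x y"
  shows "\<exists>X x. X 0 = a \<and> (\<forall>k. P k (X k) (X (Suc k))) \<and> X \<longlonglongrightarrow> x \<and> (\<forall>k. X k < x)"
proof -
  have "\<forall>k x. \<exists>y. x < y \<and> P k x y" using assms by blast
  then obtain f where f: "\<And>k x. x < f k x \<and> P k x (f k x)" by metis
  define X where "X = rec_nat a f"
  have X: "X 0 = a" "X (Suc k) = f k (X k)" for k by (simp_all add: X_def)
  obtain x where "X \<longlonglongrightarrow> x" "\<And>k. X k < x"
    using f X(2) by (auto intro: long_ray_increasing_converges[of X])
  moreover have "P k (X k) (X (Suc k))" for k using f X(2) by simp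
  ultimately show ?thesis using X(1) by blast
qed

lemma compact_image_bounded:
  fixes f :: "'a :: topological_space \<Rightarrow> long_ray"
  assumes "compact C" "continuous_on C f"
  shows "\<exists>c. \<forall>u\<in>C. f u \<le> c"
proof (cases "C = {}")
  case False
  then show ?thesis
    using continuous_attains_sup[OF assms(1) False assms(2)] by blast
qed simp

section \<open>The gaps of the Cantor set\<close>

lemma compact_cantor_set: "compact cantor_set"
proof -
  have "compact (cantor_stage n)" for n
    by (induction n) (auto intro!: compact_Un compact_continuous_image continuous_intros)
  then show ?thesis
    unfolding cantor_set_def by (intro compact_Inter) auto
qed

lemma cantor_stage_subset: "cantor_stage n \<subseteq> {0..1}"
  by (induction n) force+

text \<open>The removed middle third confines an interval to one of the two copies of the previous
  stage, and rescaling that copy triples the length.\<close>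

lemma cantor_stage_interval:
  assumes "x \<le> y" "{x..y} \<subseteq> cantor_stage n"
  shows "y - x \<le> (1/3) ^ n"
  using assms
proof (induction n arbitrary: x y)
  case (Suc n)
  let ?L = "(\<lambda>x. x / 3) ` cantor_stage n" and ?R = "(\<lambda>x. (x + 2) / 3) ` cantor_stage n"
  have L: "?L \<subseteq> {..1/3}" and R: "?R \<subseteq> {2/3..}"
    using cantor_stage_subset[of n] by auto
  have "y \<le> 1/3 \<or> 2/3 \<le> x"
  proof (rule ccontr)
    assume no: "\<not> (y \<le> 1/3 \<or> 2/3 \<le> x)"
    \<comment> \<open>The point of \<open>{x..y}\<close> nearest to \<open>1/2\<close>; it falls
      into the removed third.\<close>
    define z where "z = max x (min y (1/2))"
    have "1/3 < z" "z < 2/3" "z \<in> {x..y}"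
      using no Suc.prems(1) by (auto simp: z_def min_def max_def)
    moreover from this have "z \<in> ?L \<union> ?R"
      using subsetD[OF Suc.prems(2)] by (simp only: cantor_stage.simps)
    ultimately show False using subsetD[OF L, of z] subsetD[OF R, of z] by auto
  qed
  then show ?case
  proof
    assume "y \<le> 1/3"
    have "{3 * x..3 * y} \<subseteq> cantor_stage n"
    proof
      fix t assume "t \<in> {3 * x..3 * y}"
      then have "t / 3 \<in> {x..y}" "t / 3 < 2/3" using \<open>y \<le> 1/3\<close> by auto
      then have "t / 3 \<in> ?L \<union> ?R" "t / 3 \<notin> ?R"
        using subsetD[OF Suc.prems(2)] subsetD[OF R, of "t / 3"]
        by (simp_all only: cantor_stage.simps) auto
      then have "t / 3 \<in> ?L" by blast
      then show "t \<in> cantor_stage n" by auto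
    qed
    then show ?thesis using Suc.IH[of "3 * x" "3 * y"] Suc.prems(1) by simp
  next
    assume "2/3 \<le> x"
    have "{3 * x - 2..3 * y - 2} \<subseteq> cantor_stage n"
    proof
      fix t assume "t \<in> {3 * x - 2..3 * y - 2}"
      then have "(t + 2) / 3 \<in> {x..y}" "1/3 < (t + 2) / 3" using \<open>2/3 \<le> x\<close> by auto
      then have "(t + 2) / 3 \<in> ?L \<union> ?R" "(t + 2) / 3 \<notin> ?L"
        using subsetD[OF Suc.prems(2)] subsetD[OF L, of "(t + 2) / 3"]
        by (simp_all only: cantor_stage.simps) auto
      then have "(t + 2) / 3 \<in> ?R" by blast
      then show "t \<in> cantor_stage n" by auto
    qed
    then show ?thesis using Suc.IH[of "3 * x - 2" "3 * y - 2"] Suc.prems(1) by simp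
  qed
qed simp

lemma cantor_set_no_interval:
  assumes "x < y" shows "\<not> {x..y} \<subseteq> cantor_set"
proof
  assume sub: "{x..y} \<subseteq> cantor_set"
  obtain n where "(1/3) ^ n < y - x"
    using real_arch_pow_inv[of "y - x" "1/3"] assms by auto
  moreover have "{x..y} \<subseteq> cantor_stage n" using sub by (auto simp: cantor_set_def)
  ultimately show False using cantor_stage_interval[of x y n] assms by simp
qed

text \<open>The powers of \<open>1/3\<close> all belong to it. Infinitely many points force
  infinitely many gaps, so that the gaps can be indexed by the natural numbers.\<close>

lemma infinite_cantor_set: "infinite cantor_set"
proof
  assume fin: "finite cantor_set"
  have third: "x / 3 \<in> cantor_set" if "x \<in> cantor_set" for x
  proof -
    have x: "x \<in> cantor_stage m" for m using that by (simp add: cantor_set_def)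
    have "x / 3 \<in> cantor_stage n" for n
    proof (cases n)
      case 0
      then show ?thesis using x[of 0] by simp
    next
      case (Suc m)
      then show ?thesis using x[of m] by simp
    qed
    then show ?thesis by (simp add: cantor_set_def)
  qed
  have one: "1 \<in> cantor_set"
  proof -
    have "1 \<in> cantor_stage n" for n
      by (induction n) (auto intro: image_eqI[of _ _ 1])
    then show ?thesis by (simp add: cantor_set_def)
  qed
  have "(1/3) ^ n \<in> cantor_set" for n
    by (induction n) (use one third in auto)
  then have "range (\<lambda>n. (1/3 :: real) ^ n) \<subseteq> cantor_set" by auto
  then have "finite (range (\<lambda>n. (1/3 :: real) ^ n))" using fin finite_subset by blast
  moreover have "inj (\<lambda>n. (1/3 :: real) ^ n)" by (rule injI) (simp add: power_divide)
  ultimately show False using finite_imageD by blast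
qed

lemma compact_gap_around:
  fixes K :: "real set"
  assumes "compact K" "p \<notin> K" "k \<in> K" "k < p" "k' \<in> K" "p < k'"
  obtains a b where "a \<in> K" "b \<in> K" "k \<le> a" "a < p" "p < b" "b \<le> k'" "{a<..<b} \<inter> K = {}"
proof -
  have "compact (K \<inter> {..p})" "compact (K \<inter> {p..})"
    using assms(1) by (auto intro: compact_Int_closed)
  moreover have "K \<inter> {..p} \<noteq> {}" "K \<inter> {p..} \<noteq> {}" using assms by force+
  ultimately obtain a b where ab: "a \<in> K \<inter> {..p}" "\<And>x. x \<in> K \<inter> {..p} \<Longrightarrow> x \<le> a"
    "b \<in> K \<inter> {p..}" "\<And>x. x \<in> K \<inter> {p..} \<Longrightarrow> b \<le> x"
    using compact_attains_sup[of "K \<inter> {..p}"] compact_attains_inf[of "K \<inter> {p..}"] by metis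
  have "a \<noteq> p" "b \<noteq> p" using ab assms by auto
  then have *: "a \<in> K" "b \<in> K" "k \<le> a" "a < p" "p < b" "b \<le> k'"
    using ab(1,3) ab(2)[of k] ab(4)[of k'] assms by auto
  have "x \<notin> {a<..<b}" if "x \<in> K" for x
    using ab(2)[of x] ab(4)[of x] that by force
  then have "{a<..<b} \<inter> K = {}" by blast
  with * show thesis by (rule that)
qed

text \<open>Each \<open>g n\<close> with \<open>n > 0\<close> represents one gap, while
  \<open>g 0\<close> is an extra point below \<open>K\<close>. Apart from compactness, only the
  relative order of these points and \<open>K\<close> is used later: gaps are separated by points of
  \<open>K\<close>, and points of \<open>K\<close> are separated by gaps, which is where total
  disconnectedness enters.\<close>

locale gap_enumeration =
  fixes K :: "real set" and g :: "nat \<Rightarrow> real"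
  assumes compact_K: "compact K" and inj_g: "inj g" and g_notin_K: "g n \<notin> K"
    and g_0_less: "k \<in> K \<Longrightarrow> g 0 < k" and ex_K_above_g: "\<exists>k\<in>K. g n < k"
    and ex_K_between: "g n < g m \<Longrightarrow> \<exists>k\<in>K. g n < k \<and> k < g m"
    and ex_g_between: "k \<in> K \<Longrightarrow> k' \<in> K \<Longrightarrow> k < k' \<Longrightarrow> \<exists>n. k < g n \<and> g n < k'"

lemma ex_gap_enumeration:
  fixes K :: "real set"
  assumes K: "compact K" "infinite K" and nointerval: "\<And>x y. x < y \<Longrightarrow> \<not> {x..y} \<subseteq> K"
  shows "\<exists>g. gap_enumeration K g"
proof -
  define gap where "gap a b \<longleftrightarrow> a \<in> K \<and> b \<in> K \<and> a < b \<and> {a<..<b} \<inter> K = {}" for a b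
  define G where "G = {(a + b) / 2 | a b. gap a b}"
  have G_E: "\<exists>a\<in>K. \<exists>b\<in>K. a < m \<and> m < b \<and> m = (a + b) / 2 \<and> {a<..<b} \<inter> K = {}" if mG: "m \<in> G" for m
  proof -
    obtain a b where "m = (a + b) / 2" "gap a b" using mG unfolding G_def by blast
    then show ?thesis by (intro bexI[of _ a] bexI[of _ b]) (auto simp: gap_def)
  qed
  have GK: "m \<notin> K" if mG: "m \<in> G" for m
  proof -
    obtain a b where "a < m" "m < b" "{a<..<b} \<inter> K = {}" using G_E[OF mG] by blast
    then show ?thesis by (meson disjoint_iff greaterThanLessThan_iff)
  qed
  have sep: "\<exists>k\<in>K. m < k \<and> k < m'" if mm: "m \<in> G" "m' \<in> G" "m < m'" for m m'
  proof -
    obtain a b where ab: "a \<in> K" "b \<in> K" "a < m" "m < b" "m = (a + b) / 2" "{a<..<b} \<inter> K = {}"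
      using G_E[OF mm(1)] by blast
    obtain a' b' where ab': "a' \<in> K" "b' \<in> K" "a' < m'" "m' < b'" "m' = (a' + b') / 2" "{a'<..<b'} \<inter> K = {}"
      using G_E[OF mm(2)] by blast
    \<comment> \<open>If \<open>m' < b\<close>, the two gaps overlap; neither contains an end of the
      other, so they coincide and have the same midpoint.\<close>
    have "b < m'"
    proof (rule ccontr)
      assume "\<not> b < m'"
      then have "m' < b" using GK[OF mm(2)] ab(2) by (metis linorder_neqE)
      have "a' \<notin> {a<..<b}" "b' \<notin> {a<..<b}" "a \<notin> {a'<..<b'}" "b \<notin> {a'<..<b'}"
        using ab ab' by blast+
      then have "a' = a" "b' = b" using ab ab' mm(3) \<open>m' < b\<close> by auto
      then show False using ab ab' mm(3) by simp
    qed
    then show ?thesis using ab by blast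
  qed
  have dense: "\<exists>m\<in>G. k < m \<and> m < k'" if kk: "k \<in> K" "k' \<in> K" "k < k'" for k k'
  proof -
    obtain p where "p \<in> {k..k'}" "p \<notin> K" using nointerval[OF kk(3)] by blast
    then have p: "k < p" "p < k'" "p \<notin> K" using kk by (auto simp: less_le)
    obtain a b where ab: "a \<in> K" "b \<in> K" "k \<le> a" "a < p" "p < b" "b \<le> k'" "{a<..<b} \<inter> K = {}"
      by (rule compact_gap_around[OF K(1) p(3) kk(1) p(1) kk(2) p(2)])
    then have "gap a b" by (simp add: gap_def)
    then have "(a + b) / 2 \<in> G" unfolding G_def by blast
    moreover have "k < (a + b) / 2" "(a + b) / 2 < k'" using ab by auto
    ultimately show ?thesis by blast
  qed
  have "countable G"
  proof -
    \<comment> \<open>A rational between the midpoint and the right end identifies the gap: with a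
      common rational, no point of \<open>K\<close> could separate the two midpoints.\<close>
    have "\<exists>r\<in>\<rat>. m < r \<and> {m..r} \<inter> K = {}" if m: "m \<in> G" for m
    proof -
      obtain a b where ab: "a < m" "m < b" "{a<..<b} \<inter> K = {}"
        using G_E[OF m] by blast
      obtain r where "r \<in> \<rat>" "m < r" "r < b" using Rats_dense_in_real[OF ab(2)] by blast
      moreover have "{m..r} \<subseteq> {a<..<b}" using ab \<open>r < b\<close> by auto
      ultimately show ?thesis using ab(3) by blast
    qed
    then obtain r where r: "\<And>m. m \<in> G \<Longrightarrow> r m \<in> \<rat> \<and> m < r m \<and> {m..r m} \<inter> K = {}"
      by metis
    have no: "r m \<noteq> r m'" if mm: "m \<in> G" "m' \<in> G" "m < m'" for m m'
    proof
      assume eq: "r m = r m'"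
      obtain k where "k \<in> K" "m < k" "k < m'" using sep[OF mm] by blast
      then have "k \<in> {m..r m} \<inter> K" using conjunct1[OF conjunct2[OF r[OF mm(2)]]] eq by auto
      then show False using r[OF mm(1)] by blast
    qed
    then have "inj_on r G" by (intro linorder_inj_onI) auto
    moreover have "countable (r ` G)"
      by (rule countable_subset[OF _ countable_rat]) (use r in auto)
    ultimately show ?thesis by (metis countable_image_inj_on)
  qed
  have "infinite G"
  proof
    assume "finite G"
    \<comment> \<open>Different points of \<open>K\<close> are separated by a gap, so finitely many
      gaps would leave only finitely many points.\<close>
    have "inj_on (\<lambda>k. {m \<in> G. m < k}) K"
    proof (rule linorder_inj_onI)
      fix k k' assume kk: "k < k'" "k \<in> K" "k' \<in> K"
      then obtain m where "m \<in> G" "k < m" "m < k'" using dense by blast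
      then have "m \<notin> {m \<in> G. m < k}" "m \<in> {m \<in> G. m < k'}" by auto
      then show "{m \<in> G. m < k} \<noteq> {m \<in> G. m < k'}" by metis
    qed auto
    moreover have "finite ((\<lambda>k. {m \<in> G. m < k}) ` K)"
      by (rule finite_subset[of _ "Pow G"]) (use \<open>finite G\<close> in auto)
    ultimately show False using K(2) finite_imageD by blast
  qed
  have bij: "bij_betw (from_nat_into G) UNIV G"
    by (rule bij_betw_from_nat_into[OF \<open>countable G\<close> \<open>infinite G\<close>])
  have inf: "Inf K \<le> k" if "k \<in> K" for k
    using that compact_imp_bounded[OF K(1)] by (simp add: bounded_imp_bdd_below cInf_lower)
  define g where "g n = (case n of 0 \<Rightarrow> Inf K - 1 | Suc i \<Rightarrow> from_nat_into G i)" for n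
  have g0: "g 0 < k" if "k \<in> K" for k using inf[OF that] by (simp add: g_def)
  have gS: "g (Suc i) \<in> G" for i using bij by (auto simp: g_def bij_betw_def)
  have gG: "\<exists>n. g n = m" if mG: "m \<in> G" for m
  proof -
    obtain i where "from_nat_into G i = m" using bij mG unfolding bij_betw_def by (metis imageE)
    then have "g (Suc i) = m" by (simp add: g_def)
    then show ?thesis by blast
  qed
  have g0S: "\<exists>k\<in>K. g 0 < k \<and> k < g (Suc i)" for i
    using G_E[OF gS[of i]] g0 by blast
  have "gap_enumeration K g"
  proof
    show "compact K" by (rule K(1))
    show "inj g"
    proof (rule injI)
      fix n m assume eq: "g n = g m"
      have "g 0 \<noteq> g (Suc i)" "g (Suc i) \<noteq> g 0" for i using g0S[of i] by auto
      with eq show "n = m"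
        using bij_betw_imp_inj_on[OF bij]
        by (cases n; cases m) (auto simp: inj_eq, auto simp: g_def inj_eq)
    qed
    show "g n \<notin> K" for n
      using g0[of "g 0"] GK[OF gS] by (cases n) auto
    show "g 0 < k" if "k \<in> K" for k using that by (rule g0)
    show "\<exists>k\<in>K. g n < k" for n
      using g0S G_E[OF gS] by (cases n) blast+
    show "\<exists>k\<in>K. g n < k \<and> k < g m" if "g n < g m" for n m
    proof (cases m)
      case 0
      then have False
        using that g0S[of "n - 1"] by (cases n) auto
      then show ?thesis ..
    next
      case (Suc j)
      then show ?thesis using that g0S sep[OF gS gS] by (cases n) auto
    qed
    show "\<exists>n. k < g n \<and> g n < k'" if "k \<in> K" "k' \<in> K" "k < k'" for k k'
      using dense[OF that] gG by blast
  qed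
  then show ?thesis by (intro exI[of _ g])
qed

section \<open>The surface\<close>

context gap_enumeration
begin

lemma g_less_iff: "g n < g m \<or> g m < g n \<longleftrightarrow> n \<noteq> m"
  using inj_g by (auto simp: inj_eq neq_iff[symmetric])

lemma g_0_le: "g 0 \<le> g n"
proof (rule ccontr)
  assume "\<not> g 0 \<le> g n"
  then obtain k where "k \<in> K" "k < g 0" using ex_K_between[of n 0] by auto
  then show False using g_0_less[of k] by simp
qed

lemma g_0_less_g: "n \<noteq> 0 \<Longrightarrow> g 0 < g n"
  using g_0_le[of n] g_less_iff[of 0 n] by auto

text \<open>The coordinate \<open>p 0\<close> is the height of \<open>p\<close>. The points of height \<open>x\<close> form the arc obtained
  from \<open>K\<close> by replacing each gap by a copy of \<open>[bot, x]\<close>: the coordinate \<open>p n\<close> of a gap is \<open>bot\<close> to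
  the left of it, \<open>x\<close> to the right of it, and the position of \<open>p\<close> inside it. The index \<open>0\<close> acts as
  a gap below \<open>K\<close>.\<close>

definition surf :: "(nat \<Rightarrow> long_ray) set" where
  "surf = {p. (\<forall>n. p n \<le> p 0) \<and> (\<forall>n m. g n < g m \<longrightarrow> bot < p m \<longrightarrow> p n = p 0)}"

lemma surf_le: "p \<in> surf \<Longrightarrow> p n \<le> p 0"
  and surf_eq: "p \<in> surf \<Longrightarrow> g n < g m \<Longrightarrow> bot < p m \<Longrightarrow> p n = p 0"
  by (auto simp: surf_def)

lemma continuous_on_coordinate [continuous_intros]:
  "continuous_on A (\<lambda>p :: nat \<Rightarrow> long_ray. p i)"
  by (rule continuous_on_subset[OF continuous_on_product_coordinates]) simp

lemma closed_surf: "closed surf"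
proof -
  \<comment> \<open>The premise \<open>bot < x\<close> is an open condition, so the implication
    becomes a union of closed ones; the equality is split to fit
    \<open>closed_Collect_le\<close>.\<close>
  have iff: "(bot < x \<longrightarrow> y = z) \<longleftrightarrow> x \<le> bot \<or> y \<le> z \<and> z \<le> y" for x y z :: long_ray
    by (cases "bot < x") (auto simp: not_less)
  have "closed {p :: nat \<Rightarrow> long_ray. g n < g m \<longrightarrow> p m \<le> bot \<or> p n \<le> p 0 \<and> p 0 \<le> p n}" for n m
  proof (cases "g n < g m")
    case True
    then show ?thesis
      by (simp only: True simp_thms)
        (intro closed_Collect_disj closed_Collect_conj closed_Collect_le continuous_intros)
  qed simp
  moreover have "closed {p :: nat \<Rightarrow> long_ray. p n \<le> p 0}" for n
    by (intro closed_Collect_le continuous_intros)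
  ultimately show ?thesis
    unfolding surf_def iff by (intro closed_Collect_conj closed_Collect_all)
qed

definition initial_part :: "long_ray \<Rightarrow> (nat \<Rightarrow> long_ray) set" where
  "initial_part a = {p \<in> surf. p 0 \<le> a}"

lemma compact_initial_part: "compact (initial_part a)"
proof -
  have "compactin (product_topology (\<lambda>i::nat. euclidean) UNIV) (PiE UNIV (\<lambda>i. {..a}))"
    unfolding compactin_PiE by (simp add: compact_atMost_long_ray)
  then have "compact (PiE UNIV (\<lambda>i::nat. {..a}))"
    by (simp add: euclidean_product_topology)
  then have "compact (PiE UNIV (\<lambda>i::nat. {..a}) \<inter> surf)"
    using closed_surf by (rule compact_Int_closed)
  moreover have "PiE UNIV (\<lambda>i::nat. {..a}) \<inter> surf = initial_part a"
    by (auto simp: initial_part_def PiE_UNIV_domain Pi_iff intro: order_trans[OF surf_le])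
  ultimately show ?thesis by simp
qed

lemma bot_in_surf: "(\<lambda>_. bot) \<in> surf"
  by (simp add: surf_def)

text \<open>Cutting all coordinates of \<open>p\<close> off at \<open>x\<close> stays in the
  surface. As \<open>x\<close> runs through the connected long ray, this joins \<open>p\<close> to
  the tip, where all coordinates are \<open>bot\<close>.\<close>

lemma connected_surf: "connected surf"
proof -
  define L where "L p = range (\<lambda>x. \<lambda>n. min (p n) x)" for p :: "nat \<Rightarrow> long_ray"
  have "L p \<subseteq> surf" if p: "p \<in> surf" for p
  proof
    fix q assume "q \<in> L p"
    then obtain x where q: "q = (\<lambda>n. min (p n) x)" by (auto simp: L_def)
    have "min (p n) x \<le> min (p 0) x" for n
      using surf_le[OF p, of n] by (rule min.mono) simp
    moreover have "min (p n) x = min (p 0) x" if "g n < g m" "bot < min (p m) x" for n m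
      using surf_eq[OF p that(1)] that(2) by simp
    ultimately show "q \<in> surf" by (simp add: q surf_def)
  qed
  moreover have "p \<in> L p" if "p \<in> surf" for p
    unfolding L_def using surf_le[OF that] by (intro range_eqI[of _ _ "p 0"]) (auto simp: min_def)
  ultimately have "surf = \<Union>(L ` surf)" by blast
  moreover have "connected (\<Union>(L ` surf))"
  proof (rule connected_Union)
    fix A assume "A \<in> L ` surf"
    then obtain p where A: "A = L p" by blast
    show "connected A"
      unfolding A L_def
      by (intro connected_continuous_image connected_UNIV_long_ray continuous_intros continuous_on_min)
  next
    have "(\<lambda>_. bot) \<in> L p" for p
      unfolding L_def by (intro range_eqI[of _ _ bot]) simp
    then show "\<Inter>(L ` surf) \<noteq> {}" by blast
  qed
  ultimately show ?thesis by simp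
qed

definition exhaustion :: "omega1 \<Rightarrow> (nat \<Rightarrow> long_ray) set" where
  "exhaustion \<alpha> = {p \<in> surf. p 0 < lr_point \<alpha>}"

lemma lr_point_mono: "\<alpha> < \<beta> \<Longrightarrow> lr_point \<alpha> < lr_point \<beta>"
  by (simp add: lr_point_def lr_make_less_iff)

lemma openin_exhaustion: "openin (top_of_set surf) (exhaustion \<alpha>)"
proof -
  have "open {p :: nat \<Rightarrow> long_ray. p 0 < lr_point \<alpha>}"
    by (intro open_Collect_less continuous_intros)
  moreover have "exhaustion \<alpha> = surf \<inter> {p. p 0 < lr_point \<alpha>}" by (auto simp: exhaustion_def)
  ultimately show ?thesis by (simp add: openin_open_Int)
qed

lemma closedin_initial_part: "closedin (top_of_set surf) (initial_part a)"
proof -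
  have "closed {p :: nat \<Rightarrow> long_ray. p 0 \<le> a}"
    by (intro closed_Collect_le continuous_intros)
  moreover have "initial_part a = surf \<inter> {p. p 0 \<le> a}" by (auto simp: initial_part_def)
  ultimately show ?thesis by (simp add: closedin_closed_Int)
qed

lemma closure_of_subset_initial_part:
  assumes "\<And>p. p \<in> A \<Longrightarrow> p \<in> surf \<Longrightarrow> p 0 \<le> a"
  shows "top_of_set surf closure_of A \<subseteq> initial_part a"
proof -
  have "surf \<inter> A \<subseteq> initial_part a" using assms by (auto simp: initial_part_def)
  then have "top_of_set surf closure_of (surf \<inter> A) \<subseteq> initial_part a"
    using closedin_initial_part by (rule closure_of_minimal)
  then show ?thesis
    using closure_of_restrict[of "top_of_set surf" A] by simp
qed

lemma omega_bounded_surf: "omega_bounded (top_of_set surf)"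
  unfolding omega_bounded_def
proof (intro allI impI; elim conjE)
  fix C :: "(nat \<Rightarrow> long_ray) set" assume C: "C \<subseteq> topspace (top_of_set surf)" "countable C"
  obtain \<alpha> where "\<forall>a\<in>(\<lambda>p. p 0) ` C. a < lr_point \<alpha>"
    using countable_long_ray_bounded[of "(\<lambda>p. p 0) ` C"] C by auto
  then have "top_of_set surf closure_of C \<subseteq> initial_part (lr_point \<alpha>)"
    by (intro closure_of_subset_initial_part) (auto simp: less_imp_le)
  moreover have "compactin (top_of_set surf) (initial_part (lr_point \<alpha>))"
    by (simp add: compactin_subtopology compact_initial_part) (auto simp: initial_part_def)
  ultimately show "compactin (top_of_set surf) (top_of_set surf closure_of C)"
    by (meson closed_compactin closedin_closure_of)
qed

text \<open>This is the line at the least point of \<open>K\<close>, which has all gaps to its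
  right. It shows that every height occurs.\<close>

lemma ray_in_surf: "(\<lambda>n. if n = 0 then x else bot) \<in> surf"
  using g_0_le by (auto simp: surf_def not_less[symmetric] split: if_splits)

lemma type_I_space_surf: "type_I_space (top_of_set surf) exhaustion"
  unfolding type_I_space_def
proof (intro conjI allI impI)
  have "Hausdorff_space (euclidean :: long_ray topology)"
    unfolding Hausdorff_space_def disjnt_def using hausdorff by fastforce
  then have "Hausdorff_space (product_topology (\<lambda>i::nat. euclidean :: long_ray topology) UNIV)"
    by (simp add: Hausdorff_space_product_topology)
  then show "Hausdorff_space (top_of_set surf)"
    unfolding euclidean_product_topology by (rule Hausdorff_space_subtopology)
  have ex: "\<exists>\<alpha>. p \<in> exhaustion \<alpha>" if "p \<in> surf" for p
    using that ex_lr_point_greater[of "p 0"] by (auto simp: exhaustion_def)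
  then show un: "topspace (top_of_set surf) = (\<Union>\<alpha>. exhaustion \<alpha>)"
    by (auto simp: exhaustion_def)
  show "openin (top_of_set surf) (exhaustion \<alpha>)" for \<alpha> by (rule openin_exhaustion)
  have cl: "top_of_set surf closure_of exhaustion \<alpha> \<subseteq> initial_part (lr_point \<alpha>)" for \<alpha>
    by (rule closure_of_subset_initial_part) (simp add: exhaustion_def less_imp_le)
  show "Lindelof_space (subtopology (top_of_set surf) (top_of_set surf closure_of exhaustion \<alpha>))" for \<alpha>
  proof (rule compact_imp_Lindelof_space)
    have "compactin (top_of_set surf) (initial_part (lr_point \<alpha>))"
      by (simp add: compactin_subtopology compact_initial_part) (auto simp: initial_part_def)
    then have "compactin (top_of_set surf) (top_of_set surf closure_of exhaustion \<alpha>)"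
      using cl[of \<alpha>] by (meson closed_compactin closedin_closure_of)
    then show "compact_space (subtopology (top_of_set surf) (top_of_set surf closure_of exhaustion \<alpha>))"
      by (rule compact_space_subtopology)
  qed
  show "top_of_set surf closure_of exhaustion \<alpha> \<subseteq> exhaustion \<beta>" if "\<alpha> < \<beta>" for \<alpha> \<beta>
    using cl[of \<alpha>] lr_point_mono[OF that]
    by (auto simp: initial_part_def exhaustion_def dest!: subsetD intro: le_less_trans)
  \<comment> \<open>A countable subfamily of the exhaustion has bounded indices and misses a point
    of larger height.\<close>
  show "\<not> Lindelof_space (top_of_set surf)"
  proof
    assume "Lindelof_space (top_of_set surf)"
    then obtain \<V> where V: "countable \<V>" "\<V> \<subseteq> range exhaustion" "\<Union>\<V> = surf"
      using un openin_exhaustion unfolding Lindelof_space_def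
      by (metis (no_types, lifting) imageE topspace_euclidean_subtopology)
    then obtain A where A: "countable A" "\<V> = exhaustion ` A"
      by (metis countable_subset_image)
    obtain \<beta> where \<beta>: "\<forall>\<alpha>\<in>A. \<alpha> < \<beta>" using countable_omega1_bounded[OF A(1)] by blast
    let ?p = "\<lambda>n :: nat. if n = 0 then lr_point \<beta> else bot"
    have "?p \<in> \<Union>\<V>" unfolding V(3) by (rule ray_in_surf)
    then obtain \<alpha> where "\<alpha> \<in> A" "?p \<in> exhaustion \<alpha>" using A(2) by blast
    then show False using lr_point_mono[of \<alpha> \<beta>] \<beta> by (auto simp: exhaustion_def dest: less_asym)
  qed
qed

section \<open>Fibres and charts\<close>

text \<open>If \<open>p\<close> leads in one gap and \<open>q\<close> in another, the one that leads
  in the gap further right is already at full height in the other gap and cannot be exceeded there.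
  So each fibre is a chain, and a strictly monotone real function separates its points.\<close>

lemma surf_chain:
  assumes "p \<in> surf" "q \<in> surf" "p 0 = q 0"
  shows "(\<forall>n. p n \<le> q n) \<or> (\<forall>n. q n \<le> p n)"
proof (rule ccontr)
  assume "\<not> ?thesis"
  then obtain i j where ij: "q i < p i" "p j < q j" by (auto simp: not_le)
  then have "i \<noteq> j" by auto
  then consider "g j < g i" | "g i < g j" using g_less_iff[of i j] by blast
  then show False
  proof cases
    case 1
    have "bot < p i" using ij(1) by (rule le_less_trans[OF bot_least])
    then have "p j = q 0" using surf_eq[OF assms(1) 1] assms(3) by simp
    then show False using ij(2) surf_le[OF assms(2), of j] by simp
  next
    case 2
    have "bot < q j" using ij(2) by (rule le_less_trans[OF bot_least])
    then have "q i = p 0" using surf_eq[OF assms(2) 2] assms(3) by simp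
    then show False using ij(1) surf_le[OF assms(1), of i] by simp
  qed
qed

text \<open>The second chart coordinate is a weighted sum of the gap coordinates, read through
  \<open>e\<close>. The weights \<open>w n\<close> add up to 1, so it lies between 0 and the height;
  uniform convergence gives continuity, positive weights and \<open>surf_chain\<close> give
  injectivity, and \<open>infsum_cut\<close> gives surjectivity. Compactness then supplies a
  continuous inverse.\<close>

lemma initial_part_triangle:
  fixes e :: "long_ray \<Rightarrow> real"
  assumes mono: "strict_mono_on {..<b} e" and homeo: "homeomorphism {..<b} {0..<T} e e'" and a: "a < b"
  shows "\<exists>F G. homeomorphism (initial_part a) {(x, y). 0 \<le> y \<and> y \<le> x \<and> x \<le> e a} F G \<and>
    (\<forall>p. fst (F p) = e (p 0))"
proof -
  define w :: "nat \<Rightarrow> real" where "w n = (1/2) ^ Suc n" for n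
  have w_pos: "0 < w n" for n by (simp add: w_def)
  have w_nn: "0 \<le> w n" for n by (simp add: w_def)
  have "w sums 1" unfolding w_def by (rule power_half_series)
  then have w_has_sum: "(w has_sum 1) UNIV"
    by (intro sums_nonneg_imp_has_sum) (auto simp: w_pos less_imp_le)
  then have w_sm: "w summable_on A" for A
    by (meson has_sum_imp_summable subset_UNIV summable_on_subset_banach)
  have w_sum: "infsum w UNIV = 1" using w_has_sum by (rule infsumI)
  have le_iff: "x \<le> y \<longleftrightarrow> e x \<le> e y" if "x < b" "y < b" for x y
    using strict_mono_on_less_eq[OF mono] that by simp
  have inv: "e' (e x) = x" and e_range: "0 \<le> e x" "e x < T" if "x < b" for x
  proof -
    show "e' (e x) = x" using homeomorphism_apply1[OF homeo] that by simp
    have "e x \<in> {0..<T}" unfolding homeomorphism_image1[OF homeo, symmetric] using that by simp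
    then show "0 \<le> e x" "e x < T" by simp_all
  qed
  have inv': "e (e' t) = t" "e' t < b" if "0 \<le> t" "t < T" for t
  proof -
    show "e (e' t) = t" using homeomorphism_apply2[OF homeo] that by simp
    have "e' t \<in> {..<b}" unfolding homeomorphism_image2[OF homeo, symmetric] using that by simp
    then show "e' t < b" by simp
  qed
  have cont_e: "continuous_on {..<b} e" using homeo by (simp add: homeomorphism_def)
  have bot_b: "bot < b" using a by (rule le_less_trans[OF bot_least])
  have "0 < T" using e_range[OF bot_b] by simp
  then have e_bot: "e bot = 0"
    using le_iff[OF bot_b inv'(2)[of 0]] inv'(1)[of 0] e_range(1)[OF bot_b] by simp
  define Y where "Y p = (\<Sum>\<^sub>\<infinity>n. w n * e (p (Suc n)))" for p :: "nat \<Rightarrow> long_ray"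
  define F where "F p = (e (p 0), Y p)" for p
  define D where "D = {(x, y). 0 \<le> y \<and> y \<le> x \<and> x \<le> e a}"
  have below_b: "p n < b" if "p \<in> initial_part a" for p n
    using that surf_le[of p n] a unfolding initial_part_def by (auto intro: le_less_trans)
  have e_le: "0 \<le> e (p n)" "e (p n) \<le> e (p 0)" "e (p n) \<le> e a" if "p \<in> initial_part a" for p n
  proof -
    show "0 \<le> e (p n)" by (rule e_range[OF below_b[OF that]])
    show "e (p n) \<le> e (p 0)"
      using le_iff[OF below_b[OF that, of n] below_b[OF that, of 0]] surf_le[of p n] that
      by (simp add: initial_part_def)
    also have "\<dots> \<le> e a"
      using le_iff[OF below_b[OF that, of 0] a] that by (simp add: initial_part_def)
    finally show "e (p n) \<le> e a" .
  qed
  have summand_sm: "(\<lambda>n. w n * e (p (Suc n))) summable_on UNIV" if "p \<in> initial_part a" for p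
    by (rule summable_on_comparison_test[OF summable_on_cmult_left[OF w_sm, of "e a"]])
      (use e_le[OF that] w_nn in \<open>auto intro!: mult_left_mono mult_nonneg_nonneg\<close>)
  have contF: "continuous_on (initial_part a) F"
  proof -
    have coord: "continuous_on (initial_part a) (\<lambda>p. e (p n))" for n
      by (rule continuous_on_compose2[OF cont_e]) (auto intro: below_b continuous_intros)
    have "continuous_on (initial_part a) Y"
    proof (rule uniform_limit_theorem)
      show "\<forall>\<^sub>F X in finite_subsets_at_top UNIV.
          continuous_on (initial_part a) (\<lambda>p. \<Sum>n\<in>X. w n * e (p (Suc n)))"
        by (intro always_eventually allI continuous_intros coord)
      show "uniform_limit (initial_part a) (\<lambda>X p. \<Sum>n\<in>X. w n * e (p (Suc n))) Y
          (finite_subsets_at_top UNIV)"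
        unfolding Y_def
        by (rule Weierstrass_m_test_general[OF _ summable_on_cmult_left[OF w_sm, of "e a"]])
          (use e_le w_nn in \<open>auto simp: abs_mult intro!: mult_left_mono\<close>)
    qed simp
    then show ?thesis unfolding F_def by (intro continuous_on_Pair coord)
  qed
  have Y_bounds: "0 \<le> Y p" "Y p \<le> e (p 0)" if "p \<in> initial_part a" for p
  proof -
    show "0 \<le> Y p"
      unfolding Y_def by (intro infsum_nonneg) (use e_le[OF that] w_nn in \<open>auto intro!: mult_nonneg_nonneg\<close>)
    have "Y p \<le> (\<Sum>\<^sub>\<infinity>n. w n * e (p 0))"
      unfolding Y_def
      by (intro infsum_mono summand_sm[OF that] summable_on_cmult_left w_sm)
        (use e_le[OF that] w_nn in \<open>auto intro!: mult_left_mono\<close>)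
    also have "\<dots> = e (p 0)" by (simp add: infsum_cmult_left' w_sum)
    finally show "Y p \<le> e (p 0)" .
  qed
  have strict: "Y p < Y q"
    if pq: "p \<in> initial_part a" "q \<in> initial_part a" "\<And>n. p n \<le> q n" "p (Suc j) < q (Suc j)" for p q j
  proof -
    have le: "e (p n) \<le> e (q n)" for n
      using pq(3) le_iff[OF below_b[OF pq(1)] below_b[OF pq(2)]] by simp
    have "e (p (Suc j)) < e (q (Suc j))"
      using pq(4) le_iff[OF below_b[OF pq(2)] below_b[OF pq(1)]] by (simp add: not_le[symmetric])
    then show ?thesis
      unfolding Y_def
      using w_pos[of j] le w_nn
      by (intro has_sum_strict_mono[OF has_sum_infsum[OF summand_sm[OF pq(1)]]
            has_sum_infsum[OF summand_sm[OF pq(2)]], of j]) (auto intro!: mult_left_mono)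
  qed
  have injF: "inj_on F (initial_part a)"
  proof (rule inj_onI)
    fix p q assume pq: "p \<in> initial_part a" "q \<in> initial_part a" "F p = F q"
    have 0: "p 0 = q 0"
      using arg_cong[OF pq(3), of "\<lambda>z. e' (fst z)"]
        inv[OF below_b[OF pq(1), of 0]] inv[OF below_b[OF pq(2), of 0]]
      by (simp add: F_def)
    have Y: "Y p = Y q" using pq(3) by (simp add: F_def)
    have "p n = q n" for n
    proof (cases n)
      case (Suc j)
      show ?thesis
      proof (rule ccontr)
        assume "p n \<noteq> q n"
        then have "(\<forall>n. p n \<le> q n) \<and> p (Suc j) < q (Suc j) \<or> (\<forall>n. q n \<le> p n) \<and> q (Suc j) < p (Suc j)"
          using surf_chain[of p q] pq(1,2) 0 Suc by (auto simp: initial_part_def less_le)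
        then show False using strict[OF pq(1,2)] strict[OF pq(2,1)] Y by auto
      qed
    qed (simp add: 0)
    then show "p = q" by blast
  qed
  have "F ` initial_part a \<subseteq> D"
    using Y_bounds e_le(3)[of _ 0] by (auto simp: F_def D_def)
  moreover have "D \<subseteq> F ` initial_part a"
  proof
    fix z assume "z \<in> D"
    then obtain c y where z: "z = (c, y)" "0 \<le> y" "y \<le> c" "c \<le> e a" by (auto simp: D_def)
    have cT: "0 \<le> c" "c < T" using z e_range[OF a] by simp_all
    define x where "x = e' c"
    have x: "e x = c" "x < b" using inv'[OF cT] by (simp_all add: x_def)
    have xa: "x \<le> a" using le_iff[OF x(2) a] x z by simp
    have "\<exists>p\<in>initial_part a. p 0 = x \<and> Y p = y"
    proof (cases "c = 0")
      case True
      then have "x = bot" using le_iff[OF x(2) bot_b] x e_bot by (simp add: bot.extremum_unique)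
      moreover have "Y (\<lambda>_. bot) = y" using True z e_bot by (simp add: Y_def)
      moreover have "(\<lambda>_. bot) \<in> initial_part a" using bot_in_surf by (simp add: initial_part_def)
      ultimately show ?thesis by (intro bexI[of _ "\<lambda>_. bot"]) simp_all
    next
      case False
      then have "0 < c" using cT by simp
      \<comment> \<open>The relative position of \<open>y\<close> in the fibre. With the weights
        stacked in the order of the gaps, \<open>v\<close> either falls into the segment of one gap,
        giving a point of its octant, or cuts the gaps in two, giving a point on a line.\<close>
      define v where "v = y / c"
      have v: "0 \<le> v" "v \<le> infsum w UNIV" using z \<open>0 < c\<close> by (simp_all add: v_def w_sum)
      define lo where "lo n = infsum w {m. g (Suc m) < g (Suc n)}" for n
      have "inj (\<lambda>n. g (Suc n))" by (rule injI) (simp add: inj_eq[OF inj_g])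
      from infsum_cut[OF this w_sm _ v] w_pos
      consider n where "lo n \<le> v" "v < lo n + w n"
        | E where "infsum w E = v" "\<And>n m. n \<in> E \<Longrightarrow> g (Suc m) < g (Suc n) \<Longrightarrow> m \<in> E"
        unfolding lo_def by (auto simp: less_imp_le)
      then show ?thesis
      proof cases
        case 1
        \<comment> \<open>Chosen so that \<open>lo n + w n * t = v\<close>: gap \<open>Suc n\<close>
          is filled to the fraction \<open>t\<close>, the gaps to its left completely.\<close>
        define t where "t = (v - lo n) / w n"
        have t: "0 \<le> t" "t \<le> 1" using 1 w_pos[of n] by (simp_all add: t_def divide_simps)
        have tc: "0 \<le> t * c" "t * c \<le> c" using t \<open>0 < c\<close> by (simp_all add: mult_left_le_one_le)
        define s where "s = e' (t * c)"
        have s: "e s = t * c" "s < b" using inv'[of "t * c"] tc cT by (simp_all add: s_def)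
        have sx: "s \<le> x" using le_iff[OF s(2) x(2)] s x tc by simp
        define p where "p m = (if g m < g (Suc n) then x else if m = Suc n then s else bot)" for m
        have p0: "p 0 = x" using g_0_less_g[of "Suc n"] by (simp add: p_def)
        have "p \<in> surf"
          by (auto simp: surf_def p_def sx g_0_less_g split: if_splits)
        moreover have "Y p = y"
        proof -
          have "Y p = (\<Sum>\<^sub>\<infinity>m\<in>{m. g (Suc m) < g (Suc n)} \<union> {n}. w m * e (p (Suc m)))"
            unfolding Y_def by (rule infsum_cong_neutral) (auto simp: p_def e_bot)
          also have "\<dots> = (\<Sum>\<^sub>\<infinity>m\<in>{m. g (Suc m) < g (Suc n)}. w m * e (p (Suc m))) + w n * e (p (Suc n))"
          proof (subst infsum_Un_disjoint)
            have "(\<lambda>m. w m * c) summable_on {m. g (Suc m) < g (Suc n)}"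
              by (intro summable_on_cmult_left w_sm)
            then show "(\<lambda>m. w m * e (p (Suc m))) summable_on {m. g (Suc m) < g (Suc n)}"
              by (rule summable_on_cong[THEN iffD1, rotated]) (auto simp: p_def x)
          qed auto
          also have "(\<Sum>\<^sub>\<infinity>m\<in>{m. g (Suc m) < g (Suc n)}. w m * e (p (Suc m))) =
              (\<Sum>\<^sub>\<infinity>m\<in>{m. g (Suc m) < g (Suc n)}. w m * c)"
            by (rule infsum_cong) (auto simp: p_def x)
          also have "\<dots> = lo n * c" by (simp add: infsum_cmult_left' lo_def)
          also have "lo n * c + w n * e (p (Suc n)) = (lo n + w n * t) * c"
            by (simp add: p_def s algebra_simps)
          also have "\<dots> = y" using w_pos[of n] \<open>0 < c\<close> by (simp add: t_def v_def)
          finally show ?thesis .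
        qed
        ultimately show ?thesis using p0 xa by (auto simp: initial_part_def)
      next
        case 2
        \<comment> \<open>The weights skip coordinate 0, so the element \<open>m - 1\<close> of the
          cut \<open>E\<close> speaks about gap \<open>m\<close>; coordinate 0 is always the
          height.\<close>
        define p where "p m = (if m = 0 \<or> m - 1 \<in> E then x else bot)" for m
        have pS: "p (Suc m) = (if m \<in> E then x else bot)" and p0: "p 0 = x" for m
          by (simp_all add: p_def)
        have "p \<in> surf"
          unfolding surf_def mem_Collect_eq p0
        proof (intro conjI allI impI)
          show "p n \<le> x" for n by (simp add: p_def)
          fix n m assume nm: "g n < g m" "bot < p m"
          then have "m \<noteq> 0" using g_0_le[of n] by (intro notI) simp
          then obtain m' where m': "m = Suc m'" by (cases m) auto
          then have "m' \<in> E" using nm(2) by (auto simp: pS split: if_splits)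
          then show "p n = x"
            using nm(1) 2(2)[of m'] m' by (cases n) (auto simp: p0 pS)
        qed
        moreover have "Y p = y"
        proof -
          have "Y p = (\<Sum>\<^sub>\<infinity>m\<in>E. w m * c)"
            unfolding Y_def by (rule infsum_cong_neutral) (auto simp: pS e_bot x)
          then show ?thesis using \<open>0 < c\<close> by (simp add: infsum_cmult_left' 2(1) v_def)
        qed
        ultimately show ?thesis using p0 xa by (auto simp: initial_part_def)
      qed
    qed
    then obtain p where "p \<in> initial_part a" "F p = z" using x z by (auto simp: F_def)
    then show "z \<in> F ` initial_part a" by blast
  qed
  ultimately have "F ` initial_part a = D" by (rule antisym)
  then obtain G where "homeomorphism (initial_part a) D F G"
    using homeomorphism_compact[OF compact_initial_part contF _ injF] by blast
  then show ?thesis unfolding D_def[symmetric] by (intro exI[of _ F] exI[of _ G]) (simp add: F_def)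
qed

text \<open>One chart covers a whole member of the exhaustion, namely a triangle without its far
  side. Its corner at the tip has to be flattened to match the half plane.\<close>

lemma surface_surf: "surface (top_of_set surf)"
  unfolding surface_def
proof (intro conjI ballI)
  show "Hausdorff_space (top_of_set surf)"
    using type_I_space_surf unfolding type_I_space_def by (rule conjunct1)
  show "connected_space (top_of_set surf)" by (simp add: connected_surf connected_space_subtopology)
  fix p assume "p \<in> topspace (top_of_set surf)"
  then have p: "p \<in> surf" by simp
  obtain \<alpha> where \<alpha>: "p 0 < lr_point \<alpha>" using ex_lr_point_greater by blast
  define a where "a = lr_point \<alpha>"
  \<comment> \<open>Leaves room above \<open>a\<close>, so that the real chart covers the compact
    \<open>initial_part a\<close>, on which the triangle homeomorphism lives.\<close>
  obtain \<beta> where \<beta>: "a < lr_point \<beta>" using ex_lr_point_greater by blast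
  obtain e e' T where e: "strict_mono_on {..<lr_point \<beta>} e"
    "homeomorphism {..<lr_point \<beta>} {0..<T :: real} e e'"
    by (rule initial_segment_homeomorphism[of \<beta>])
  define c where "c = e a"
  define D where "D = {(x, y). 0 \<le> y \<and> y \<le> x \<and> x \<le> c}"
  obtain F G where F: "homeomorphism (initial_part a) D F G" "\<And>p. fst (F p) = e (p 0)"
    using initial_part_triangle[OF e \<beta>] unfolding D_def c_def by blast
  \<comment> \<open>Opens the corner: the sides \<open>y = 0\<close> and \<open>y = x\<close> of the
    triangle become the two halves of the boundary line. If \<open>(u, v)\<close> is the image of
    \<open>(x, y)\<close>, then \<open>x = \<bar>u\<bar> + 2 * v\<close>; this explains \<sigma>,
    \<open>W'\<close> and \<open>W\<close>.\<close>
  define \<rho> :: "real \<times> real \<Rightarrow> real \<times> real" where "\<rho> z = (fst z - 2 * snd z, min (fst z - snd z) (snd z))" for z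
  define \<sigma> :: "real \<times> real \<Rightarrow> real \<times> real"
    where "\<sigma> z = (\<bar>fst z\<bar> + 2 * snd z, (\<bar>fst z\<bar> + 2 * snd z - fst z) / 2)" for z
  define W' where "W' = {z :: real \<times> real. 0 \<le> snd z \<and> \<bar>fst z\<bar> + 2 * snd z \<le> c}"
  define W where "W = {z :: real \<times> real. 0 \<le> snd z \<and> \<bar>fst z\<bar> + 2 * snd z < c}"
  have \<rho>: "homeomorphism D W' \<rho> \<sigma>"
  proof (rule homeomorphismI)
    show "continuous_on D \<rho>" unfolding \<rho>_def by (intro continuous_intros)
    show "continuous_on W' \<sigma>" unfolding \<sigma>_def by (intro continuous_intros) simp
    show "\<rho> ` D \<subseteq> W'" by (auto simp: \<rho>_def D_def W'_def min_def abs_if)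
    show "\<sigma> ` W' \<subseteq> D" by (auto simp: \<sigma>_def D_def W'_def)
    show "\<sigma> (\<rho> z) = z" if "z \<in> D" for z using that by (auto simp: \<rho>_def \<sigma>_def D_def prod_eq_iff min_def abs_if field_simps split: if_splits)
    show "\<rho> (\<sigma> z) = z" if "z \<in> W'" for z using that by (auto simp: \<rho>_def \<sigma>_def W'_def prod_eq_iff min_def abs_if field_simps split: if_splits)
  qed
  have comp: "homeomorphism (initial_part a) W' (\<rho> \<circ> F) (G \<circ> \<sigma>)"
    by (rule homeomorphism_compose[OF F(1) \<rho>])
  have sub: "exhaustion \<alpha> \<subseteq> initial_part a" by (auto simp: exhaustion_def initial_part_def a_def)
  have mem: "q \<in> exhaustion \<alpha> \<longleftrightarrow> \<bar>fst ((\<rho> \<circ> F) q)\<bar> + 2 * snd ((\<rho> \<circ> F) q) < c"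
    if q: "q \<in> initial_part a" for q
  proof -
    have "F q \<in> D" using F(1) q by (auto simp: homeomorphism_def)
    then have "\<bar>fst (\<rho> (F q))\<bar> + 2 * snd (\<rho> (F q)) = e (q 0)"
      using F(2)[of q] by (cases "F q") (auto simp: \<rho>_def D_def min_def abs_if)
    moreover have "q 0 \<in> {..<lr_point \<beta>}" "a \<in> {..<lr_point \<beta>}"
      using q \<beta> by (auto simp: initial_part_def)
    then have "q 0 < a \<longleftrightarrow> e (q 0) < c" unfolding c_def using strict_mono_on_less[OF e(1)] by blast
    ultimately show ?thesis using q by (simp add: exhaustion_def initial_part_def a_def)
  qed
  have "(\<rho> \<circ> F) ` exhaustion \<alpha> = W"
  proof (intro equalityI subsetI)
    fix z assume "z \<in> (\<rho> \<circ> F) ` exhaustion \<alpha>"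
    then obtain q where q: "q \<in> exhaustion \<alpha>" "z = (\<rho> \<circ> F) q" by blast
    then have "z \<in> W'" using homeomorphism_image1[OF comp] sub by blast
    then show "z \<in> W" using mem[of q] q sub unfolding W_def W'_def by auto
  next
    fix z assume z: "z \<in> W"
    then have "z \<in> W'" by (simp add: W_def W'_def)
    then obtain q where q: "q \<in> initial_part a" "z = (\<rho> \<circ> F) q"
      using homeomorphism_image1[OF comp] by blast
    then show "z \<in> (\<rho> \<circ> F) ` exhaustion \<alpha>" using mem[OF q(1)] z by (auto simp: W_def)
  qed
  then have "homeomorphism (exhaustion \<alpha>) W (\<rho> \<circ> F) (G \<circ> \<sigma>)"
    by (intro homeomorphism_of_subsets[OF comp sub order_refl])
  then have "top_of_set (exhaustion \<alpha>) homeomorphic_space top_of_set W"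
    unfolding homeomorphic_space_def homeomorphic_maps_def
    by (intro exI[of _ "\<rho> \<circ> F"] exI[of _ "G \<circ> \<sigma>"]) (auto simp: homeomorphism_def)
  moreover have "subtopology (top_of_set surf) (exhaustion \<alpha>) = top_of_set (exhaustion \<alpha>)"
    by (simp add: subtopology_subtopology) (auto simp: exhaustion_def Int_def intro!: arg_cong[of _ _ top_of_set])
  moreover have "openin (top_of_set {p :: real \<times> real. 0 \<le> snd p}) W"
  proof -
    have "open {z :: real \<times> real. \<bar>fst z\<bar> + 2 * snd z < c}"
      by (intro open_Collect_less continuous_intros)
    moreover have "W = {p. 0 \<le> snd p} \<inter> {z. \<bar>fst z\<bar> + 2 * snd z < c}" by (auto simp: W_def)
    ultimately show ?thesis by (simp add: openin_open_Int)
  qed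
  moreover have "p \<in> exhaustion \<alpha>" using p \<alpha> by (simp add: exhaustion_def)
  ultimately show "\<exists>V W. openin (top_of_set surf) V \<and> p \<in> V \<and>
        openin (top_of_set {p :: real \<times> real. 0 \<le> snd p}) W \<and>
        subtopology (top_of_set surf) V homeomorphic_space top_of_set W"
    using openin_exhaustion[of \<alpha>] by (intro exI[of _ "exhaustion \<alpha>"] exI[of _ W]) simp
qed

section \<open>Unboundedness along lines and strips\<close>

lemma tendsto_coordinate:
  fixes p :: "nat \<Rightarrow> nat \<Rightarrow> long_ray"
  assumes "p \<longlonglongrightarrow> q"
  shows "(\<lambda>k. p k i) \<longlonglongrightarrow> q i"
  using continuous_on_tendsto_compose[OF continuous_on_coordinate[of UNIV i] assms] by simp

text \<open>The point \<open>p\<close> is a limit of points of \<open>A\<close> whose heights are interleaved with the values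
  of all the functions.\<close>

lemma ex_common_fixed_height:
  fixes F :: "nat \<Rightarrow> (nat \<Rightarrow> long_ray) \<Rightarrow> long_ray" and f :: "nat \<Rightarrow> long_ray \<Rightarrow> long_ray"
  assumes A: "closed A" "A \<subseteq> surf"
    and F: "\<And>i. continuous_on surf (F i)" "\<And>k a. \<exists>p\<in>A. a < p 0 \<and> (\<forall>i\<le>k. a < F i p)"
    and f: "\<And>i. continuous_on UNIV (f i)" "\<And>i a. \<exists>x. a < f i x"
  shows "\<exists>p\<in>A. a < p 0 \<and> (\<forall>i. F i p = p 0) \<and> (\<forall>i. f i (p 0) = p 0)"
proof -
  \<comment> \<open>There are two kinds of demands. The \<open>F i\<close> must be large at one and
    the same point of \<open>A\<close>, so stage \<open>k\<close> treats only those with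
    \<open>i \<le> k\<close>. Each \<open>f i\<close> depends on the height alone and gets a witness
    \<open>u\<close> of its own, so all of them are treated at every stage.\<close>
  define P where "P k x y \<longleftrightarrow> (\<exists>p\<in>A. x < p 0 \<and> p 0 < y \<and> (\<forall>i\<le>k. x < F i p \<and> F i p < y)) \<and>
      (\<forall>i. \<exists>u. x < u \<and> u < y \<and> x < f i u \<and> f i u < y)" for k x y
  have ex: "\<exists>y>x. P k x y" for k x
  proof -
    obtain p where p: "p \<in> A" "x < p 0" "\<And>i. i \<le> k \<Longrightarrow> x < F i p" using F(2)[of x k] by blast
    \<comment> \<open>\<open>f i\<close> is bounded on the compact \<open>{..x}\<close>, so a value
      above that bound is taken beyond \<open>x\<close>.\<close>
    have "\<exists>u>x. x < f i u" for i
    proof -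
      obtain c where c: "\<And>u. u \<le> x \<Longrightarrow> f i u \<le> c"
        using compact_image_bounded[OF compact_atMost_long_ray continuous_on_subset[OF f(1)[of i] subset_UNIV]]
        by (metis atMost_iff)
      obtain u where u: "max c x < f i u" using f(2) by blast
      then have "\<not> u \<le> x" using c[of u] by auto
      then show ?thesis using u by (intro exI[of _ u]) auto
    qed
    then obtain u where u: "x < u i" "x < f i (u i)" for i by metis
    obtain \<alpha> where \<alpha>: "\<forall>a\<in>insert x (insert (p 0) (range (\<lambda>i. F i p) \<union> range u \<union> range (\<lambda>i. f i (u i)))). a < lr_point \<alpha>"
      using countable_long_ray_bounded[of "insert x (insert (p 0) (range (\<lambda>i. F i p) \<union> range u \<union> range (\<lambda>i. f i (u i))))"]
      by auto
    have "P k x (lr_point \<alpha>)"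
      unfolding P_def
    proof (intro conjI allI)
      show "\<exists>p\<in>A. x < p 0 \<and> p 0 < lr_point \<alpha> \<and> (\<forall>i\<le>k. x < F i p \<and> F i p < lr_point \<alpha>)"
        using p \<alpha> by (intro bexI[of _ p]) auto
      show "\<exists>u. x < u \<and> u < lr_point \<alpha> \<and> x < f i u \<and> f i u < lr_point \<alpha>" for i
        using u[of i] \<alpha> by (intro exI[of _ "u i"]) auto
    qed
    then show ?thesis using \<alpha> by blast
  qed
  obtain X x where X: "X 0 = a" "\<And>k. P k (X k) (X (Suc k))" "X \<longlonglongrightarrow> x" "\<And>k. X k < x"
    using long_ray_interleave[of P a, OF ex] by blast
  \<comment> \<open>Anything trapped between consecutive terms of \<open>X\<close> converges to
    \<open>x\<close>; \<open>r\<close> allows for the subsequence that compactness selects.\<close>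
  have squeeze: "v \<longlonglongrightarrow> x"
    if "\<forall>\<^sub>F k in sequentially. X (r k) < v k" "\<forall>\<^sub>F k in sequentially. v k < X (Suc (r k))" "strict_mono r"
    for v :: "nat \<Rightarrow> long_ray" and r :: "nat \<Rightarrow> nat"
  proof (rule tendsto_sandwich)
    show "\<forall>\<^sub>F k in sequentially. X (r k) \<le> v k" "\<forall>\<^sub>F k in sequentially. v k \<le> X (Suc (r k))"
      using that(1,2) by (auto elim: eventually_mono)
    show "(\<lambda>k. X (r k)) \<longlonglongrightarrow> x" "(\<lambda>k. X (Suc (r k))) \<longlonglongrightarrow> x"
      using LIMSEQ_subseq_LIMSEQ[OF X(3) that(3)] LIMSEQ_subseq_LIMSEQ[OF LIMSEQ_Suc[OF X(3)] that(3)]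
      by (simp_all add: o_def)
  qed
  have "\<exists>p\<in>A. X k < p 0 \<and> p 0 < X (Suc k) \<and> (\<forall>i\<le>k. X k < F i p \<and> F i p < X (Suc k))" for k
    using X(2)[of k] unfolding P_def by blast
  then obtain p where p: "\<And>k. p k \<in> A" "\<And>k. X k < p k 0" "\<And>k. p k 0 < X (Suc k)"
    "\<And>k i. i \<le> k \<Longrightarrow> X k < F i (p k) \<and> F i (p k) < X (Suc k)"
    by metis
  have "p k \<in> initial_part x" for k
    using p(1,3)[of k] X(4)[of "Suc k"] A(2) by (auto simp: initial_part_def)
  moreover have "seq_compact (initial_part x)"
    by (rule compact_imp_seq_compact[OF compact_initial_part])
  ultimately obtain q r where r: "q \<in> initial_part x" "strict_mono (r :: nat \<Rightarrow> nat)" "(p \<circ> r) \<longlonglongrightarrow> q"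
    unfolding seq_compact_def by metis
  have "q \<in> A"
    using A(1) p(1) r(3) unfolding closed_sequential_limits by (metis comp_apply)
  have lim: "(\<lambda>k. p (r k) 0) \<longlonglongrightarrow> x"
    by (rule squeeze[OF _ _ r(2)]) (simp_all add: p)
  have q0: "q 0 = x"
    using tendsto_coordinate[OF r(3), of 0] lim by (auto simp: o_def intro: LIMSEQ_unique)
  have "F i q = x" for i
  proof (rule LIMSEQ_unique)
    have "p (r k) \<in> surf" for k using p(1) A(2) by blast
    then show "(\<lambda>k. F i (p (r k))) \<longlonglongrightarrow> F i q"
      using r(1) r(3) by (intro continuous_on_tendsto_compose[OF F(1)[of i]])
        (auto simp: initial_part_def o_def)
    \<comment> \<open>\<open>F i\<close> is under control only from stage \<open>i\<close>
      on.\<close>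
    have "\<forall>\<^sub>F k in sequentially. i \<le> r k"
      using seq_suble[OF r(2)] by (auto simp: eventually_sequentially intro!: exI[of _ i] intro: order_trans)
    then show "(\<lambda>k. F i (p (r k))) \<longlonglongrightarrow> x"
      by (intro squeeze[OF _ _ r(2)]) (auto elim!: eventually_mono dest: p(4))
  qed
  moreover have "f i x = x" for i
  proof -
    have "\<exists>u. X k < u \<and> u < X (Suc k) \<and> X k < f i u \<and> f i u < X (Suc k)" for k
      using X(2)[of k] unfolding P_def by blast
    then obtain u where u: "\<And>k. X k < u k \<and> u k < X (Suc k) \<and> X k < f i (u k) \<and> f i (u k) < X (Suc k)"
      by metis
    have id: "strict_mono (\<lambda>k::nat. k)" by (simp add: strict_mono_def)
    have "u \<longlonglongrightarrow> x" "(\<lambda>k. f i (u k)) \<longlonglongrightarrow> x"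
      using u by (auto intro: squeeze[OF _ _ id])
    moreover have "(\<lambda>k. f i (u k)) \<longlonglongrightarrow> f i x"
      using continuous_on_tendsto_compose[OF f(1)[of i] \<open>u \<longlonglongrightarrow> x\<close>] by simp
    ultimately show ?thesis by (auto intro: LIMSEQ_unique)
  qed
  moreover have "a < x" using X(1,4) by metis
  ultimately show ?thesis using \<open>q \<in> A\<close> q0 by (intro bexI[of _ q]) auto
qed

text \<open>On the compact part of height at most \<open>a\<close> the function is bounded, so its
  large values occur at large heights, and the interleaving lemma applies with every
  \<open>F i\<close> equal to \<open>f\<close>.\<close>

lemma ex_fixed_height:
  assumes A: "closed A" "A \<subseteq> surf" and f: "continuous_on surf f" "\<And>a. \<exists>p\<in>A. a < f p"
  shows "\<exists>p\<in>A. a < p 0 \<and> f p = p 0"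
proof -
  have "\<exists>p\<in>A. a < p 0 \<and> a < f p" for a
  proof -
    obtain c where c: "\<forall>p\<in>initial_part a. f p \<le> c"
      using compact_image_bounded[OF compact_initial_part continuous_on_subset[OF f(1)]]
      by (auto simp: initial_part_def)
    obtain p where p: "p \<in> A" "max c a < f p" using f(2) by blast
    then have "p \<notin> initial_part a" using c by (auto simp: not_le)
    then show ?thesis using p A(2) by (intro bexI[of _ p]) (auto simp: initial_part_def)
  qed
  then have "\<exists>p\<in>A. a < p 0 \<and> (\<forall>i::nat. f p = p 0) \<and> (\<forall>i::nat. p 0 = p 0)"
    using ex_lr_point_greater by (intro ex_common_fixed_height A f(1) continuous_on_id) blast+
  then show ?thesis by blast
qed

text \<open>For a convergent sequence of unbounded parameters there is a height above
  \<open>a\<close> which \<open>f\<close> takes as its value on all the corresponding lines, and the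
  equality passes to the limit parameter. For bounded parameters, countably many bounds have a
  common bound. The lemma is applied to \<open>{0..1}\<close> across a strip and to \<open>K\<close>
  across the lines.\<close>

lemma clopen_unbounded_lines:
  fixes f :: "(nat \<Rightarrow> long_ray) \<Rightarrow> long_ray" and T :: "real set" and h :: "real \<Rightarrow> long_ray \<Rightarrow> nat \<Rightarrow> long_ray"
  assumes T: "closed T" and f: "continuous_on surf f"
    and h: "\<And>t x. t \<in> T \<Longrightarrow> h t x \<in> surf" "\<And>t. t \<in> T \<Longrightarrow> continuous_on UNIV (h t)"
      "\<And>x. continuous_on T (\<lambda>t. h t x)"
  shows "closed {t \<in> T. \<forall>a. \<exists>x. a < f (h t x)}" "closed {t \<in> T. \<exists>a. \<forall>x. f (h t x) \<le> a}"
proof -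
  have cont_x: "continuous_on UNIV (\<lambda>x. f (h t x))" if "t \<in> T" for t
    by (rule continuous_on_compose2[OF f h(2)[OF that]]) (use h(1)[OF that] in auto)
  have cont_t: "continuous_on T (\<lambda>t. f (h t x))" for x
    by (rule continuous_on_compose2[OF f h(3)]) (use h(1) in auto)
  show "closed {t \<in> T. \<forall>a. \<exists>x. a < f (h t x)}"
    unfolding closed_sequential_limits
  proof (intro allI impI; elim conjE)
    fix s :: "nat \<Rightarrow> real" and t
    assume s: "\<forall>n. s n \<in> {t \<in> T. \<forall>a. \<exists>x. a < f (h t x)}" "s \<longlonglongrightarrow> t"
    then have "t \<in> T" using T unfolding closed_sequential_limits by blast
    have "\<exists>x. a < f (h t x)" for a
    proof -
      \<comment> \<open>Here \<open>p\<close> is wanted only for its height: every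
        \<open>F i\<close> is the height itself, and the functions of interest are the
        \<open>f i\<close>.\<close>
      have "\<exists>p\<in>surf. a < p 0 \<and> (\<forall>i::nat. p 0 = p 0) \<and> (\<forall>i. f (h (s i) (p 0)) = p 0)"
      proof (rule ex_common_fixed_height[OF closed_surf order_refl])
        show "continuous_on surf (\<lambda>p. p 0)" by (rule continuous_on_coordinate)
        show "\<exists>p\<in>surf. a < p 0 \<and> (\<forall>i\<le>k. a < p 0)" for k :: nat and a
          using ray_in_surf ex_lr_point_greater[of a] by (metis (mono_tags, lifting))
        show "continuous_on UNIV (\<lambda>x. f (h (s i) x))" for i using s(1) by (intro cont_x) simp
        show "\<exists>x. a < f (h (s i) x)" for i a using s(1) by simp
      qed
      then obtain x where x: "a < x" "\<And>i. f (h (s i) x) = x" by blast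
      have "(\<lambda>i. f (h (s i) x)) \<longlonglongrightarrow> f (h t x)"
        using s \<open>t \<in> T\<close> by (intro continuous_on_tendsto_compose[OF cont_t[of x]]) auto
      then have "f (h t x) = x" unfolding x(2) by (simp add: LIMSEQ_const_iff)
      then show ?thesis using x(1) by (intro exI[of _ x]) simp
    qed
    then show "t \<in> {t \<in> T. \<forall>a. \<exists>x. a < f (h t x)}" using \<open>t \<in> T\<close> by simp
  qed
  show "closed {t \<in> T. \<exists>a. \<forall>x. f (h t x) \<le> a}"
    unfolding closed_sequential_limits
  proof (intro allI impI; elim conjE)
    fix s :: "nat \<Rightarrow> real" and t
    assume s: "\<forall>n. s n \<in> {t \<in> T. \<exists>a. \<forall>x. f (h t x) \<le> a}" "s \<longlonglongrightarrow> t"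
    then have "t \<in> T" using T unfolding closed_sequential_limits by blast
    have "\<forall>i. \<exists>a. \<forall>x. f (h (s i) x) \<le> a" using s(1) by blast
    then obtain c where c: "\<And>i x. f (h (s i) x) \<le> c i" by metis
    obtain \<alpha> where \<alpha>: "\<And>i. c i < lr_point \<alpha>"
      using countable_long_ray_bounded[of "range c"] by auto
    have "f (h t x) \<le> lr_point \<alpha>" for x
    proof (rule LIMSEQ_le_const2)
      show "(\<lambda>i. f (h (s i) x)) \<longlonglongrightarrow> f (h t x)"
        using s \<open>t \<in> T\<close> by (intro continuous_on_tendsto_compose[OF cont_t[of x]]) auto
      show "\<exists>N. \<forall>n\<ge>N. f (h (s n) x) \<le> lr_point \<alpha>"
        using c \<alpha> by (intro exI[of _ 0] allI impI) (rule order_trans[OF c less_imp_le])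
    qed
    then show "t \<in> {t \<in> T. \<exists>a. \<forall>x. f (h t x) \<le> a}" using \<open>t \<in> T\<close> by blast
  qed
qed

section \<open>Lines and strips\<close>

text \<open>For \<open>k\<close> in \<open>K\<close> this says that \<open>k\<close> is the left end
  of gap \<open>m\<close>.\<close>

definition adjacent :: "real \<Rightarrow> nat \<Rightarrow> bool" where
  "adjacent k m \<longleftrightarrow> k < g m \<and> (\<forall>n. k < g n \<longrightarrow> g m \<le> g n)"

text \<open>In the octant of gap \<open>m\<close>, which begins at the line at \<open>k\<close>,
  this is the horizontal ray at level \<open>c\<close>, preceded by the part of the diagonal below
  it: the position in a gap cannot exceed the height, hence \<open>min c x\<close>. Level
  \<open>bot\<close> gives the line at \<open>k\<close> itself, whichever gap is named.\<close>

definition strip :: "real \<Rightarrow> nat \<Rightarrow> long_ray \<Rightarrow> long_ray \<Rightarrow> nat \<Rightarrow> long_ray" where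
  "strip k m c x n = (if g n < k then x else if n = m then min c x else bot)"

abbreviation line :: "real \<Rightarrow> long_ray \<Rightarrow> nat \<Rightarrow> long_ray" where
  "line k \<equiv> strip k 0 bot"

lemma strip_bot: "strip k m bot = line k"
  by (auto simp: strip_def fun_eq_iff)

lemma not_g_less_iff: "k \<in> K \<Longrightarrow> \<not> g n < k \<longleftrightarrow> k < g n"
  using g_notin_K[of n] by (metis less_asym linorder_neqE)

lemma strip_0: "k \<in> K \<Longrightarrow> strip k m c x 0 = x"
  using g_0_less by (simp add: strip_def)

lemma strip_in_surf:
  assumes k: "k \<in> K" and c: "c = bot \<or> adjacent k m"
  shows "strip k m c x \<in> surf"
  unfolding surf_def mem_Collect_eq strip_0[OF k]
proof (intro conjI allI impI)
  show "strip k m c x n \<le> x" for n by (simp add: strip_def)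
  fix n j assume nj: "g n < g j" "bot < strip k m c x j"
  have "g n < k"
  proof (cases "g j < k")
    case False
    then have "j = m" "c \<noteq> bot" using nj(2) by (auto simp: strip_def split: if_splits)
    then have "g n < g m" "adjacent k m" using c nj(1) by auto
    then have "\<not> k < g n" by (auto simp: adjacent_def not_le[symmetric])
    then show ?thesis using not_g_less_iff[OF k, of n] by blast
  qed (use nj in simp)
  then show "strip k m c x n = x" by (simp add: strip_def)
qed

lemma line_in_surf: "k \<in> K \<Longrightarrow> line k x \<in> surf"
  by (simp add: strip_in_surf)

lemma continuous_on_strip: "continuous_on UNIV (strip k m c)"
proof (rule continuous_on_coordinatewise_then_product)
  show "continuous_on UNIV (\<lambda>x. strip k m c x n)" for n
    unfolding strip_def
    by (cases "g n < k"; cases "n = m") (auto intro!: continuous_on_min continuous_on_id continuous_on_const)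
qed

lemma continuous_on_strip_height:
  assumes "continuous_on T \<psi>"
  shows "continuous_on T (\<lambda>t. strip k m (\<psi> t) x)"
proof (rule continuous_on_coordinatewise_then_product)
  show "continuous_on T (\<lambda>t. strip k m (\<psi> t) x n)" for n
    unfolding strip_def
    by (cases "g n < k"; cases "n = m") (auto intro!: continuous_on_min assms continuous_on_const)
qed

text \<open>No \<open>g n\<close> lies in \<open>K\<close>, so nearby parameters are on the same
  side of \<open>g n\<close> and each coordinate is locally constant.\<close>

lemma continuous_on_line_parameter: "continuous_on K (\<lambda>k. line k x)"
proof (rule continuous_on_coordinatewise_then_product)
  fix n
  have "((\<lambda>k. line k x n) \<longlongrightarrow> line k x n) (at k within K)" if k: "k \<in> K" for k
  proof (rule tendsto_eventually)
    consider "g n < k" | "k < g n" using not_g_less_iff[OF k, of n] by blast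
    then show "\<forall>\<^sub>F k' in at k within K. line k' x n = line k x n"
    proof cases
      case 1
      have "\<forall>\<^sub>F k' in at k within K. g n < k'"
        by (rule order_tendstoD(1)[OF tendsto_ident_at 1])
      then show ?thesis by eventually_elim (use 1 in \<open>simp add: strip_def\<close>)
    next
      case 2
      have "\<forall>\<^sub>F k' in at k within K. k' < g n"
        by (rule order_tendstoD(2)[OF tendsto_ident_at 2])
      then show ?thesis by eventually_elim (use 2 in \<open>auto simp: strip_def\<close>)
    qed
  qed
  then show "continuous_on K (\<lambda>k. line k x n)" by (simp add: continuous_on_def)
qed

text \<open>A strip is a product of a long ray with an arc, so the clopen set of parameters at which
  \<open>f\<close> is unbounded is everything or empty; countably many parameters suffice to control \<open>f\<close>.\<close>

lemma strip_dichotomy: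
  fixes f :: "(nat \<Rightarrow> long_ray) \<Rightarrow> long_ray"
  assumes k: "k \<in> K" and c: "c = bot \<or> adjacent k m" and f: "continuous_on surf f"
  shows "\<exists>s :: nat \<Rightarrow> long_ray. (\<forall>i. s i \<le> c) \<and>
    (\<forall>x a. (\<forall>i. f (strip k m (s i) x) \<le> a) \<longrightarrow> (\<forall>d\<le>c. f (strip k m d x) \<le> a)) \<and>
    (\<forall>x a. (\<forall>i. a \<le> f (strip k m (s i) x)) \<longrightarrow> (\<forall>d\<le>c. a \<le> f (strip k m d x))) \<and>
    (\<forall>i. (\<forall>a. \<exists>x. a < f (strip k m (s i) x)) \<longleftrightarrow> (\<forall>a. \<exists>x. a < f (line k x)))"
proof -
  obtain \<psi> :: "real \<Rightarrow> long_ray" where \<psi>: "continuous_on {0..1} \<psi>" "\<psi> ` {0..1} = {..c}" "\<psi> 0 = bot"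
    by (rule atMost_long_ray_image[of c])
  have \<psi>_le: "\<psi> t \<le> c" if "t \<in> {0..1}" for t using \<psi>(2) that by blast
  define h where "h t = strip k m (\<psi> t)" for t
  have h_surf: "h t x \<in> surf" if "t \<in> {0..1}" for t x
    unfolding h_def using c \<psi>_le[OF that] by (intro strip_in_surf k) (auto simp: bot.extremum_unique)
  have h_x: "continuous_on UNIV (h t)" if "t \<in> {0..1}" for t
    unfolding h_def by (rule continuous_on_strip)
  have h_t: "continuous_on {0..1} (\<lambda>t. h t x)" for x
    unfolding h_def by (intro continuous_on_strip_height \<psi>)
  have cont: "continuous_on {0..1} (\<lambda>t. f (h t x))" for x
    by (rule continuous_on_compose2[OF f h_t]) (use h_surf in auto)
  define Y where "Y = {t \<in> {0..1}. \<forall>a. \<exists>x. a < f (h t x)}"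
  define Z where "Z = {t \<in> {0..1}. \<exists>a. \<forall>x. f (h t x) \<le> a}"
  have YZ: "closed Y" "closed Z"
    unfolding Y_def Z_def
    by (rule clopen_unbounded_lines[OF closed_atLeastAtMost f h_surf h_x h_t]; assumption)+
  have disj: "Y \<inter> Z \<inter> {0..1} = {}" and un: "{0..1} \<subseteq> Y \<union> Z"
    by (auto simp: Y_def Z_def not_less not_le[symmetric])
  have "Y \<inter> {0..1} = {} \<or> Z \<inter> {0..1} = {}"
    by (rule connected_closedD[OF connected_Icc disj un YZ])
  moreover have "Y \<subseteq> {0..1}" by (auto simp: Y_def)
  ultimately have dich: "Y = {} \<or> Y = {0..1}" using un by blast
  \<comment> \<open>A dense sequence of levels: at fixed height, upper and lower bounds on
    \<open>f\<close> are closed conditions, so they extend from these levels to all.\<close>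
  obtain Q where Q: "countable Q" "Q \<subseteq> {0..1::real}" "{0..1} \<subseteq> closure Q"
    by (rule separable)
  have "Q \<noteq> {}" using Q(3) by auto
  define q where "q = from_nat_into Q"
  have range_q: "range q = Q" unfolding q_def by (rule range_from_nat_into[OF \<open>Q \<noteq> {}\<close> Q(1)])
  have q: "q i \<in> {0..1}" for i using rangeI[of q i] Q(2) unfolding range_q by blast
  have dense: "P t" if "closed {t \<in> {0..1}. P t}" "\<And>i. P (q i)" "t \<in> {0..1}" for P and t :: real
  proof -
    have "Q \<subseteq> {t \<in> {0..1}. P t}" using that(2) q range_q by auto
    then have "closure Q \<subseteq> {t \<in> {0..1}. P t}" using that(1) by (rule closure_minimal)
    then show ?thesis using Q(3) that(3) by blast
  qed
  have par: "\<exists>t\<in>{0..1}. strip k m d = h t" if "d \<le> c" for d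
  proof -
    have "d \<in> \<psi> ` {0..1}" using \<psi>(2) that by simp
    then show ?thesis by (auto simp: h_def)
  qed
  show ?thesis
  proof (intro exI[of _ "\<lambda>i. \<psi> (q i)"] conjI allI impI)
    show "\<psi> (q i) \<le> c" for i using q by (rule \<psi>_le)
    show "f (strip k m d x) \<le> a" if le: "\<forall>i. f (strip k m (\<psi> (q i)) x) \<le> a" and d: "d \<le> c" for x a d
    proof -
      obtain t where t: "t \<in> {0..1}" "strip k m d = h t" using par[OF d] by blast
      have "closed ({0..1} \<inter> (\<lambda>t. f (h t x)) -` {..a})"
        by (rule continuous_closed_preimage[OF cont]) auto
      moreover have "{0..1} \<inter> (\<lambda>t. f (h t x)) -` {..a} = {t \<in> {0..1}. f (h t x) \<le> a}" by auto
      moreover have "f (h (q i) x) \<le> a" for i using le by (simp add: h_def)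
      ultimately have "f (h t x) \<le> a" using t(1) dense[of "\<lambda>t. f (h t x) \<le> a" t] by metis
      then show ?thesis using t(2) by simp
    qed
    show "a \<le> f (strip k m d x)" if le: "\<forall>i. a \<le> f (strip k m (\<psi> (q i)) x)" and d: "d \<le> c" for x a d
    proof -
      obtain t where t: "t \<in> {0..1}" "strip k m d = h t" using par[OF d] by blast
      have "closed ({0..1} \<inter> (\<lambda>t. f (h t x)) -` {a..})"
        by (rule continuous_closed_preimage[OF cont]) auto
      moreover have "{0..1} \<inter> (\<lambda>t. f (h t x)) -` {a..} = {t \<in> {0..1}. a \<le> f (h t x)}" by auto
      moreover have "a \<le> f (h (q i) x)" for i using le by (simp add: h_def)
      ultimately have "a \<le> f (h t x)" using t(1) dense[of "\<lambda>t. a \<le> f (h t x)" t] by metis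
      then show ?thesis using t(2) by simp
    qed
    have "h 0 = line k" unfolding h_def \<psi>(3) by (rule strip_bot)
    then have "(\<forall>a. \<exists>x. a < f (line k x)) \<longleftrightarrow> 0 \<in> Y" by (simp add: Y_def)
    moreover have "(\<forall>a. \<exists>x. a < f (strip k m (\<psi> (q i)) x)) \<longleftrightarrow> q i \<in> Y" for i
      using q[of i] by (simp add: Y_def h_def)
    moreover have "q i \<in> Y \<longleftrightarrow> 0 \<in> Y" for i using dich q[of i] by auto
    ultimately show "(\<forall>a. \<exists>x. a < f (strip k m (\<psi> (q i)) x)) \<longleftrightarrow> (\<forall>a. \<exists>x. a < f (line k x))" for i
      by blast
  qed
qed

text \<open>The function is unbounded on all the levels \<open>s i\<close>, so some height is its
  value on all of them simultaneously, and both inequalities extend to the whole arc. Drawing the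
  height from \<open>A\<close> is what later allows a point of a given club to be hit.\<close>

lemma strip_unbounded:
  fixes f :: "(nat \<Rightarrow> long_ray) \<Rightarrow> long_ray"
  assumes k: "k \<in> K" and c: "c = bot \<or> adjacent k m" and f: "continuous_on surf f"
    and unb: "\<forall>a. \<exists>x. a < f (line k x)"
    and A: "closed A" "A \<subseteq> surf" "\<And>a. \<exists>p\<in>A. a < p 0"
  shows "\<exists>p\<in>A. a < p 0 \<and> (\<forall>d\<le>c. f (strip k m d (p 0)) = p 0)"
proof -
  from strip_dichotomy[OF k c f] obtain s :: "nat \<Rightarrow> long_ray" where s: "\<forall>i. s i \<le> c"
    "\<forall>x a. (\<forall>i. f (strip k m (s i) x) \<le> a) \<longrightarrow> (\<forall>d\<le>c. f (strip k m d x) \<le> a)"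
    "\<forall>x a. (\<forall>i. a \<le> f (strip k m (s i) x)) \<longrightarrow> (\<forall>d\<le>c. a \<le> f (strip k m d x))"
    "\<forall>i. (\<forall>a. \<exists>x. a < f (strip k m (s i) x)) \<longleftrightarrow> (\<forall>a. \<exists>x. a < f (line k x))"
    by (elim exE conjE) (rule that)
  have "\<exists>p\<in>A. a < p 0 \<and> (\<forall>i::nat. p 0 = p 0) \<and> (\<forall>i. f (strip k m (s i) (p 0)) = p 0)"
  proof (rule ex_common_fixed_height[OF A(1,2)])
    show "continuous_on surf (\<lambda>p. p 0)" by (rule continuous_on_coordinate)
    show "\<exists>p\<in>A. a < p 0 \<and> (\<forall>i\<le>k. a < p 0)" for k :: nat and a using A(3) by blast
    have "s i = bot \<or> adjacent k m" for i using c s(1)[rule_format, of i] by (auto simp: bot.extremum_unique)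
    then show "continuous_on UNIV (\<lambda>x. f (strip k m (s i) x))" for i
      by (intro continuous_on_compose2[OF f continuous_on_strip]) (use strip_in_surf[OF k] in blast)
    show "\<exists>x. a < f (strip k m (s i) x)" for i a using s(4)[rule_format, of i] unb by simp
  qed
  then obtain p where p: "p \<in> A" "a < p 0" "\<And>i. f (strip k m (s i) (p 0)) = p 0" by blast
  have "f (strip k m d (p 0)) = p 0" if "d \<le> c" for d
    using s(2)[rule_format, of "p 0" "p 0", OF _ that] s(3)[rule_format, of "p 0" "p 0", OF _ that] p(3)
    by (simp add: antisym)
  then show ?thesis using p by blast
qed

lemma strip_bounded:
  fixes f :: "(nat \<Rightarrow> long_ray) \<Rightarrow> long_ray"
  assumes k: "k \<in> K" and c: "c = bot \<or> adjacent k m" and f: "continuous_on surf f"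
    and bdd: "\<not> (\<forall>a. \<exists>x. a < f (line k x))"
  shows "\<exists>a. \<forall>d\<le>c. \<forall>x. f (strip k m d x) \<le> a"
proof -
  from strip_dichotomy[OF k c f] obtain s :: "nat \<Rightarrow> long_ray" where s: "\<forall>i. s i \<le> c"
    "\<forall>x a. (\<forall>i. f (strip k m (s i) x) \<le> a) \<longrightarrow> (\<forall>d\<le>c. f (strip k m d x) \<le> a)"
    "\<forall>x a. (\<forall>i. a \<le> f (strip k m (s i) x)) \<longrightarrow> (\<forall>d\<le>c. a \<le> f (strip k m d x))"
    "\<forall>i. (\<forall>a. \<exists>x. a < f (strip k m (s i) x)) \<longleftrightarrow> (\<forall>a. \<exists>x. a < f (line k x))"
    by (elim exE conjE) (rule that)
  have "\<exists>a. \<forall>x. f (strip k m (s i) x) \<le> a" for i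
    using s(4)[rule_format, of i] bdd by (simp add: not_less)
  then obtain b where b: "\<And>i x. f (strip k m (s i) x) \<le> b i" by metis
  obtain \<alpha> where \<alpha>: "\<And>i. b i < lr_point \<alpha>" using countable_long_ray_bounded[of "range b"] by auto
  have "f (strip k m (s i) x) \<le> lr_point \<alpha>" for i x
    using order_trans[OF b less_imp_le[OF \<alpha>]] .
  then show ?thesis using s(2)[rule_format, of _ "lr_point \<alpha>"] by blast
qed

section \<open>Unboundedness passes to the right\<close>

lemma closed_fixed_height:
  fixes f :: "(nat \<Rightarrow> long_ray) \<Rightarrow> long_ray"
  assumes A: "closed A" "A \<subseteq> surf" and f: "continuous_on surf f"
  shows "closed {p \<in> A. f p = p 0}"
  unfolding closed_sequential_limits
proof (intro allI impI; elim conjE)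
  fix p :: "nat \<Rightarrow> nat \<Rightarrow> long_ray" and q
  assume p: "\<forall>n. p n \<in> {p \<in> A. f p = p 0}" and q: "p \<longlonglongrightarrow> q"
  have qA: "q \<in> A" using A(1) p q unfolding closed_sequential_limits by blast
  have "p n \<in> surf" for n using p A(2) by blast
  then have "(\<lambda>n. f (p n)) \<longlonglongrightarrow> f q"
    using q qA A(2) by (intro continuous_on_tendsto_compose[OF f]) auto
  moreover have "(\<lambda>n. f (p n)) \<longlonglongrightarrow> q 0" using tendsto_coordinate[OF q, of 0] p by simp
  ultimately show "q \<in> {p \<in> A. f p = p 0}" using qA by (auto intro: LIMSEQ_unique)
qed

text \<open>Every strip of fixed level has points at which \<open>f\<close> equals the height, so
  such points reach arbitrarily high levels in gap \<open>m\<close>. On the closed set of all of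
  them in the octant the coordinate \<open>p m\<close> is unbounded, hence it equals the height at
  some high point, and that point lies on the diagonal.\<close>

lemma octant_unbounded:
  fixes f :: "(nat \<Rightarrow> long_ray) \<Rightarrow> long_ray"
  assumes k: "k \<in> K" "k' \<in> K" and m: "adjacent k m" "g m < k'"
    and gap: "\<And>n. g n < k' \<Longrightarrow> n = m \<or> g n < k"
    and f: "continuous_on surf f" and unb: "\<forall>a. \<exists>x. a < f (line k x)"
  shows "\<exists>x. a < f (line k' x)"
proof -
  \<comment> \<open>The points at which \<open>f\<close> equals the height, in the octant between
    the lines at \<open>k\<close> and \<open>k'\<close>.\<close>
  define A where "A = {p \<in> surf. f p = p 0} \<inter>
    (\<Inter>n\<in>{n. g n < k}. {p. p n = p 0}) \<inter> (\<Inter>n\<in>{n. k' < g n}. {p. p n \<le> bot})"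
  have eq: "{p :: nat \<Rightarrow> long_ray. p n = p 0} = {p. p n \<le> p 0} \<inter> {p. p 0 \<le> p n}" for n
    by (auto intro: antisym)
  have "closed {p :: nat \<Rightarrow> long_ray. p n = p 0}" for n
    unfolding eq by (intro closed_Int closed_Collect_le continuous_intros)
  moreover have "closed {p :: nat \<Rightarrow> long_ray. p n \<le> bot}" for n
    by (intro closed_Collect_le continuous_intros)
  moreover have "closed {p \<in> surf. f p = p 0}"
    by (rule closed_fixed_height[OF closed_surf order_refl f])
  ultimately have "closed A" unfolding A_def by (intro closed_Int closed_INT) auto
  have "A \<subseteq> surf" by (auto simp: A_def)
  have "\<exists>p\<in>A. b < p m" for b
  proof -
    obtain \<gamma> where \<gamma>: "b < lr_point \<gamma>" using ex_lr_point_greater by blast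
    let ?c = "lr_point \<gamma>"
    have surf_unb: "\<exists>p\<in>surf. a < p 0" for a
      using ray_in_surf ex_lr_point_greater[of a] by (metis (mono_tags, lifting))
    obtain q :: "nat \<Rightarrow> long_ray" where q: "?c < q 0" "\<And>d. d \<le> ?c \<Longrightarrow> f (strip k m d (q 0)) = q 0"
      using strip_unbounded[OF k(1) _ f unb closed_surf order_refl surf_unb, of ?c m ?c] m(1) by blast
    define p where "p = strip k m ?c (q 0)"
    have p0: "p 0 = q 0" by (simp add: p_def strip_0[OF k(1)])
    have pm: "p m = ?c" using q(1) m(1) by (simp add: p_def strip_def adjacent_def not_less)
    have "p \<in> surf" unfolding p_def using m(1) by (intro strip_in_surf k) simp
    moreover have "f p = p 0" using q(2)[of ?c] by (simp add: p0) (simp add: p_def)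
    moreover have "p n = p 0" if "g n < k" for n using that unfolding p0 by (simp add: p_def strip_def)
    moreover have "p n = bot" if "k' < g n" for n
    proof -
      have "n \<noteq> m" "\<not> g n < k" using that m by (auto simp: adjacent_def)
      then show ?thesis by (simp add: p_def strip_def)
    qed
    ultimately have "p \<in> A" by (simp add: A_def)
    then show ?thesis using pm \<gamma> by (intro bexI[of _ p]) simp_all
  qed
  then obtain q where q: "q \<in> A" "a < q 0" "q m = q 0"
    using ex_fixed_height[OF \<open>closed A\<close> \<open>A \<subseteq> surf\<close>, of "\<lambda>p. p m" a]
    by (auto intro: continuous_on_coordinate)
  have "q = line k' (q 0)"
  proof
    fix n
    show "q n = line k' (q 0) n"
    proof (cases "g n < k'")
      case True
      then show ?thesis using gap[OF True] q by (auto simp: strip_def A_def)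
    next
      case False
      then have "k' < g n" using not_g_less_iff[OF k(2)] by blast
      then show ?thesis using q(1) False by (auto simp: strip_def A_def bot.extremum_unique)
    qed
  qed
  moreover have "f q = q 0" using q(1) by (simp add: A_def)
  ultimately show ?thesis using q(2) by (intro exI[of _ "q 0"]) simp
qed

text \<open>Otherwise take the last unbounded parameter \<open>s\<close> up to \<open>k'\<close> and
  the first bounded one \<open>i\<close> after it; both exist because the two sets are closed. No
  point of \<open>K\<close> lies between them, so they are the ends of a gap, and its octant
  contradicts the choice of \<open>i\<close>.\<close>

lemma line_unbounded_mono:
  fixes f :: "(nat \<Rightarrow> long_ray) \<Rightarrow> long_ray"
  assumes k: "k \<in> K" "k' \<in> K" "k \<le> k'" and f: "continuous_on surf f"
    and unb: "\<forall>a. \<exists>x. a < f (line k x)"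
  shows "\<forall>a. \<exists>x. a < f (line k' x)"
proof (rule ccontr)
  assume no: "\<not> ?thesis"
  define Y where "Y = {t \<in> K. \<forall>a. \<exists>x. a < f (line t x)}"
  define Z where "Z = {t \<in> K. \<exists>a. \<forall>x. f (line t x) \<le> a}"
  have YZ: "closed Y" "closed Z"
    unfolding Y_def Z_def
    by (rule clopen_unbounded_lines[OF compact_imp_closed[OF compact_K] f];
        simp add: line_in_surf continuous_on_strip continuous_on_line_parameter)+
  have disj: "t \<notin> Y" if "t \<in> Z" for t using that by (auto simp: Y_def Z_def not_less)
  have un: "t \<in> Y" if "t \<in> K" "t \<notin> Z" for t using that by (auto simp: Y_def Z_def not_le)
  have kY: "k \<in> Y" using k unb by (simp add: Y_def)
  have k'Z: "k' \<in> Z" using k no by (auto simp: Z_def not_less)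
  have "compact (K \<inter> (Y \<inter> {..k'}))"
    using YZ by (intro compact_Int_closed compact_K) auto
  moreover have "k \<in> K \<inter> (Y \<inter> {..k'})" using k kY by simp
  ultimately obtain s where s: "s \<in> K" "s \<in> Y" "s \<le> k'" "\<And>t. t \<in> K \<Longrightarrow> t \<in> Y \<Longrightarrow> t \<le> k' \<Longrightarrow> t \<le> s"
    using compact_attains_sup[of "K \<inter> (Y \<inter> {..k'})"] by auto
  have "compact (K \<inter> (Z \<inter> {s..}))"
    using YZ by (intro compact_Int_closed compact_K) auto
  moreover have "k' \<in> K \<inter> (Z \<inter> {s..})" using k k'Z s by simp
  ultimately obtain i where i: "i \<in> K" "i \<in> Z" "s \<le> i" "\<And>t. t \<in> K \<Longrightarrow> t \<in> Z \<Longrightarrow> s \<le> t \<Longrightarrow> i \<le> t"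
    using compact_attains_inf[of "K \<inter> (Z \<inter> {s..})"] by auto
  have si: "s < i" using i(3) disj[OF i(2)] s(2) by (cases "s = i") auto
  have ik': "i \<le> k'" using i(4)[OF k(2) k'Z s(3)] .
  have gap: "\<not> (s < t \<and> t < i)" if "t \<in> K" for t
    using s(4)[of t] i(4)[of t] un[of t] that ik' by fastforce
  obtain m where m: "s < g m" "g m < i" using ex_g_between[OF s(1) i(1) si] by blast
  have same: "n = m" if "s < g n" "g n < i" for n
  proof (rule ccontr)
    assume "n \<noteq> m"
    then consider "g n < g m" | "g m < g n" using g_less_iff[of n m] by blast
    then show False
    proof cases
      case 1
      then obtain t where "t \<in> K" "g n < t" "t < g m" using ex_K_between by blast
      then show False using gap[of t] that m by simp
    next
      case 2
      then obtain t where "t \<in> K" "g m < t" "t < g n" using ex_K_between by blast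
      then show False using gap[of t] that m by simp
    qed
  qed
  have "adjacent s m"
    unfolding adjacent_def
  proof (intro conjI allI impI m)
    fix n assume "s < g n"
    then show "g m \<le> g n" using same[of n] m by fastforce
  qed
  moreover have "n = m \<or> g n < s" if "g n < i" for n
    using same[of n] that not_g_less_iff[OF s(1), of n] by blast
  ultimately have "\<forall>a. \<exists>x. a < f (line i x)"
    using octant_unbounded[OF s(1) i(1) _ m(2) _ f] s(2) by (simp add: Y_def)
  then show False using disj[OF i(2)] i(1) by (simp add: Y_def)
qed

section \<open>Directions\<close>

definition unbounded_coordinates :: "(nat \<Rightarrow> long_ray) set \<Rightarrow> nat set" where
  "unbounded_coordinates A = {n. \<forall>a. \<exists>p\<in>A. a < p n}"

abbreviation surf_club :: "(nat \<Rightarrow> long_ray) set \<Rightarrow> bool" where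
  "surf_club \<equiv> club (top_of_set surf) exhaustion"

lemma surf_club_iff: "surf_club A \<longleftrightarrow> closed A \<and> A \<subseteq> surf \<and> (\<forall>a. \<exists>p\<in>A. a < p 0)"
proof -
  have "unbounded_wrt exhaustion A \<longleftrightarrow> (\<forall>a. \<exists>p\<in>A. a < p 0)" if "A \<subseteq> surf"
  proof
    assume unb: "unbounded_wrt exhaustion A"
    show "\<forall>a. \<exists>p\<in>A. a < p 0"
    proof
      fix a
      obtain \<alpha> where \<alpha>: "a < lr_point \<alpha>" using ex_lr_point_greater by blast
      have "\<not> A \<subseteq> exhaustion \<alpha>" using unb by (simp add: unbounded_wrt_def)
      then obtain p where "p \<in> A" "lr_point \<alpha> \<le> p 0"
        using \<open>A \<subseteq> surf\<close> by (auto simp: exhaustion_def subset_iff not_less)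
      then show "\<exists>p\<in>A. a < p 0" using \<alpha> by (intro bexI[of _ p]) simp_all
    qed
  next
    assume unb: "\<forall>a. \<exists>p\<in>A. a < p 0"
    have "\<not> A \<subseteq> exhaustion \<alpha>" for \<alpha>
    proof
      assume "A \<subseteq> exhaustion \<alpha>"
      moreover obtain p where "p \<in> A" "lr_point \<alpha> < p 0" using unb by blast
      ultimately show False by (auto simp: exhaustion_def dest: less_asym)
    qed
    then show "unbounded_wrt exhaustion A" by (simp add: unbounded_wrt_def)
  qed
  then show ?thesis
    unfolding club_def closedin_closed_eq[OF closed_surf] by blast
qed

text \<open>By \<open>surf_eq\<close> the set is closed downwards in the order of the gaps. The
  required \<open>k\<close> is the least point of \<open>K\<close> above all its samples; it is
  unique because two points of \<open>K\<close> have a gap between them.\<close>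

lemma unbounded_coordinates_eq:
  assumes A: "surf_club A"
  shows "\<exists>!k. k \<in> K \<and> unbounded_coordinates A = {n. g n < k}"
proof -
  define D where "D = unbounded_coordinates A"
  have surf: "A \<subseteq> surf" and zero: "0 \<in> D"
    using A by (simp_all add: surf_club_iff D_def unbounded_coordinates_def)
  have lower: "j \<in> D" if "n \<in> D" "g j < g n" for j n
    unfolding D_def unbounded_coordinates_def mem_Collect_eq
  proof
    fix a
    obtain p where p: "p \<in> A" "a < p n" using \<open>n \<in> D\<close> by (auto simp: D_def unbounded_coordinates_def)
    have "bot < p n" using p(2) by (rule le_less_trans[OF bot_least])
    then have "p j = p 0" using surf_eq[OF _ that(2)] p(1) surf by blast
    then have "a < p j" using p surf surf_le[of p n] by auto
    then show "\<exists>p\<in>A. a < p j" using p(1) by blast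
  qed
  obtain M where M: "M \<in> K" "\<And>k. k \<in> K \<Longrightarrow> k \<le> M"
    using compact_attains_sup[OF compact_K] ex_K_above_g[of 0] by blast
  have gM: "g n \<le> M" for n using ex_K_above_g[of n] M(2) by fastforce
  have "compact (K \<inter> (\<Inter>n\<in>D. {g n..}))"
    by (intro compact_Int_closed compact_K closed_INT) auto
  moreover have "K \<inter> (\<Inter>n\<in>D. {g n..}) \<noteq> {}" using M(1) gM by auto
  ultimately obtain k where inf: "k \<in> K \<inter> (\<Inter>n\<in>D. {g n..})" "\<forall>t\<in>K \<inter> (\<Inter>n\<in>D. {g n..}). k \<le> t"
    using compact_attains_inf[of "K \<inter> (\<Inter>n\<in>D. {g n..})"] by blast
  have k: "k \<in> K" "\<And>n. n \<in> D \<Longrightarrow> g n \<le> k"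
    "\<And>t. t \<in> K \<Longrightarrow> (\<And>n. n \<in> D \<Longrightarrow> g n \<le> t) \<Longrightarrow> k \<le> t"
    using inf by auto
  have "g n < k" if "n \<in> D" for n
    using k(1) k(2)[OF that] g_notin_K[of n] by (auto simp: le_less)
  moreover have "j \<in> D" if j: "g j < k" for j
  proof (rule ccontr)
    assume "j \<notin> D"
    have below: "\<exists>t\<in>K. g n < t \<and> t < g j" if "n \<in> D" for n
    proof (rule ex_K_between)
      have "n \<noteq> j" "\<not> g j < g n" using that \<open>j \<notin> D\<close> lower by auto
      then show "g n < g j" using g_less_iff[of n j] by blast
    qed
    \<comment> \<open>Points of \<open>K\<close> separate the samples of \<open>D\<close> from
      \<open>g j\<close>, so the last point \<open>l\<close> of \<open>K\<close> before
      \<open>g j\<close> is already an upper bound of them, although it is smaller than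
      \<open>k\<close>.\<close>
    have "compact (K \<inter> {..g j})" by (intro compact_Int_closed compact_K) auto
    moreover have "K \<inter> {..g j} \<noteq> {}" using below[OF zero] by force
    ultimately obtain l where l: "l \<in> K" "l \<le> g j" "\<And>t. t \<in> K \<Longrightarrow> t \<le> g j \<Longrightarrow> t \<le> l"
      using compact_attains_sup[of "K \<inter> {..g j}"] by auto
    have "g n \<le> l" if "n \<in> D" for n
      using below[OF that] l(3) by force
    then have "k \<le> l" using l(1) by (intro k(3))
    then show False using j l(2) by simp
  qed
  ultimately have Dk: "D = {n. g n < k}" by blast
  have uniq: "t = k" if t: "t \<in> K" "D = {n. g n < t}" for t
  proof (rule ccontr)
    assume "t \<noteq> k"
    then consider "t < k" | "k < t" by (metis linorder_neqE)
    then show False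
    proof cases
      case 1
      then obtain n where "t < g n" "g n < k" using ex_g_between[OF t(1) k(1)] by blast
      moreover have "g n < k \<longleftrightarrow> g n < t" using Dk t(2) by blast
      ultimately show False by simp
    next
      case 2
      then obtain n where "k < g n" "g n < t" using ex_g_between[OF k(1) t(1)] by blast
      moreover have "g n < k \<longleftrightarrow> g n < t" using Dk t(2) by blast
      ultimately show False by simp
    qed
  qed
  show ?thesis
    unfolding D_def[symmetric] using k(1) Dk uniq by blast
qed

definition club_index :: "(nat \<Rightarrow> long_ray) set \<Rightarrow> real" where
  "club_index A = (THE k. k \<in> K \<and> unbounded_coordinates A = {n. g n < k})"

lemma club_index:
  assumes "surf_club A"
  shows "club_index A \<in> K" "unbounded_coordinates A = {n. g n < club_index A}"
  using theI'[OF unbounded_coordinates_eq[OF assms]] by (simp_all add: club_index_def)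

lemma club_index_mono:
  assumes "surf_club A" "surf_club B" "unbounded_coordinates A \<subseteq> unbounded_coordinates B"
  shows "club_index A \<le> club_index B"
proof (rule ccontr)
  assume "\<not> ?thesis"
  then obtain n where "club_index B < g n" "g n < club_index A"
    using ex_g_between[OF club_index(1)[OF assms(2)] club_index(1)[OF assms(1)]] by auto
  then have "n \<in> unbounded_coordinates A" "n \<notin> unbounded_coordinates B"
    by (simp_all add: club_index(2) assms(1,2))
  then show False using assms(3) by blast
qed

section \<open>Clubs near a line\<close>

text \<open>For \<open>k\<close> in \<open>K\<close> its trace on the surface lies in the strips of
  levels up to \<open>c\<close>: the line at \<open>k\<close>, thickened into gap \<open>m\<close>.
  Stated through coordinates it is a closed condition, and it keeps its meaning when
  \<open>k\<close> is not the left end of a gap and \<open>c\<close> is \<open>bot\<close>.\<close>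

definition fat_line :: "real \<Rightarrow> nat \<Rightarrow> long_ray \<Rightarrow> (nat \<Rightarrow> long_ray) set" where
  "fat_line k m c = {p. \<forall>n. (g n < k \<longrightarrow> p n = p 0) \<and> (k < g n \<longrightarrow> p n \<le> (if n = m then c else bot))}"

lemma closed_fat_line: "closed (fat_line k m c)"
proof -
  have "closed {p :: nat \<Rightarrow> long_ray. p n = p 0}" for n
  proof -
    have "{p :: nat \<Rightarrow> long_ray. p n = p 0} = {p. p n \<le> p 0} \<inter> {p. p 0 \<le> p n}" by (auto intro: antisym)
    then show ?thesis by (auto intro!: closed_Int closed_Collect_le continuous_intros)
  qed
  then have "closed {p :: nat \<Rightarrow> long_ray. g n < k \<longrightarrow> p n = p 0}" for n
    by (cases "g n < k") simp_all
  moreover have "closed {p :: nat \<Rightarrow> long_ray. k < g n \<longrightarrow> p n \<le> (if n = m then c else bot)}" for n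
  proof (cases "k < g n")
    case True
    have "closed {p :: nat \<Rightarrow> long_ray. p n \<le> (if n = m then c else bot)}"
      by (intro closed_Collect_le continuous_on_coordinate continuous_on_const)
    then show ?thesis using True by (simp only: simp_thms)
  qed simp
  ultimately show ?thesis
    unfolding fat_line_def by (intro closed_Collect_all closed_Collect_conj)
qed

lemma fat_line_strip:
  assumes k: "k \<in> K" and p: "p \<in> surf" "p \<in> fat_line k m c"
  shows "\<exists>d\<le>c. p = strip k m d (p 0)"
proof -
  have below: "p n = p 0" if "g n < k" for n using p(2) that by (simp add: fat_line_def)
  have above: "p n \<le> (if n = m then c else bot)" if "\<not> g n < k" for n
    using p(2) that not_g_less_iff[OF k, of n] unfolding fat_line_def by blast
  \<comment> \<open>If gap \<open>m\<close> lies left of \<open>k\<close>, its coordinate is the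
    full height and not a level; level \<open>bot\<close> then stands for the line itself.\<close>
  define d where "d = (if g m < k then bot else p m)"
  have "d \<le> c" using above[of m] by (simp add: d_def)
  moreover have "p = strip k m d (p 0)"
  proof
    fix n
    show "p n = strip k m d (p 0) n"
    proof (cases "g n < k")
      case False
      show ?thesis
      proof (cases "n = m")
        case True
        then have "strip k m d (p 0) n = min (p m) (p 0)" using False by (simp add: strip_def d_def)
        then show ?thesis using surf_le[OF p(1), of m] True by (simp add: min_absorb1)
      next
        case n: False
        then have "p n = bot" using above[OF False] by (simp add: bot.extremum_unique)
        then show ?thesis using False n by (simp add: strip_def)
      qed
    qed (simp add: strip_def below)
  qed
  ultimately show ?thesis by blast
qed

text \<open>If the gaps above \<open>k\<close> have a least element \<open>m\<close>, then the club keeps a bounded height in that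
  gap; otherwise every coordinate above \<open>k\<close> is eventually forced to vanish.\<close>

lemma club_meets_fat_line:
  assumes A: "surf_club A"
  defines "k \<equiv> club_index A"
  shows "\<exists>m c. (c = bot \<or> adjacent k m) \<and> surf_club (A \<inter> fat_line k m c)"
proof -
  have cl: "closed A" "A \<subseteq> surf" "\<And>a. \<exists>p\<in>A. a < p 0" using A by (auto simp: surf_club_iff)
  have kK: "k \<in> K" and unb: "(\<forall>a. \<exists>p\<in>A. a < p n) \<longleftrightarrow> g n < k" for n
    using club_index[OF A] by (auto simp: k_def unbounded_coordinates_def)
  \<comment> \<open>Coordinates right of \<open>k\<close> are replaced by the height, so that the
    family is indexed by all of \<open>nat\<close> and each member is unbounded on
    \<open>A\<close>.\<close>
  define F where "F n p = (if g n < k then p n else p 0)" for n and p :: "nat \<Rightarrow> long_ray"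
  have full: "\<exists>p\<in>A. a < p 0 \<and> (\<forall>n. g n < k \<longrightarrow> p n = p 0)" for a
  proof -
    have "\<exists>p\<in>A. a < p 0 \<and> (\<forall>n. F n p = p 0) \<and> (\<forall>i::nat. p 0 = p 0)"
    proof (rule ex_common_fixed_height[OF cl(1,2)])
      show "continuous_on surf (F n)" for n
        unfolding F_def by (cases "g n < k") (simp_all add: continuous_on_coordinate)
      show "\<exists>p\<in>A. a < p 0 \<and> (\<forall>i\<le>j. a < F i p)" for j a
      proof -
        \<comment> \<open>A large coordinate in the rightmost of finitely many gaps forces full
          height in the others, which turns separate unboundedness into simultaneous unboundedness.
          Index 0 keeps the set nonempty.\<close>
        define I where "I = insert 0 {i. i \<le> j \<and> g i < k}"
        have I: "finite I" "I \<noteq> {}" by (auto simp: I_def)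
        then have "Max (g ` I) \<in> g ` I" by simp
        then obtain n where n: "n \<in> I" "Max (g ` I) = g n" by blast
        have "g n < k" using n(1) g_0_less[OF kK] by (auto simp: I_def)
        then obtain p where p: "p \<in> A" "a < p n" using unb[of n] by blast
        have pS: "p \<in> surf" using p(1) cl(2) by blast
        have "bot < p n" using p(2) by (rule le_less_trans[OF bot_least])
        then have "a < p i" if "i \<in> I" for i
        proof (cases "i = n")
          case False
          have "g i \<le> g n" using that I n(2) by (metis Max_ge finite_imageI imageI)
          then have "g i < g n" using False g_less_iff[of i n] by auto
          then have "p i = p 0" using surf_eq[OF pS _ \<open>bot < p n\<close>] by blast
          then show ?thesis using p(2) surf_le[OF pS, of n] by simp
        qed (use p in simp)
        then show ?thesis
          using p(1) by (intro bexI[of _ p]) (auto simp: I_def F_def)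
      qed
    qed (use ex_lr_point_greater in \<open>auto intro: continuous_on_id\<close>)
    then obtain p where p: "p \<in> A" "a < p 0" "\<And>n. F n p = p 0" by blast
    have "p n = p 0" if "g n < k" for n using p(3)[of n] that by (simp add: F_def)
    then show ?thesis using p by blast
  qed
  have bdd: "\<exists>c. \<forall>p\<in>A. p n \<le> c" if "k < g n" for n
    using unb[of n] that by (auto simp: not_less)
  have "\<exists>m c. (c = bot \<or> adjacent k m) \<and> (\<exists>b. \<forall>p\<in>A. b < p 0 \<longrightarrow>
      (\<forall>n. k < g n \<longrightarrow> p n \<le> (if n = m then c else bot)))"
  proof (cases "\<exists>m. adjacent k m")
    case True
    then obtain m where m: "adjacent k m" by blast
    then obtain c where c: "\<And>p. p \<in> A \<Longrightarrow> p m \<le> c" using bdd[of m] by (auto simp: adjacent_def)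
    have "p n \<le> bot" if "p \<in> A" "c < p 0" "k < g n" "n \<noteq> m" for p n
    proof (rule ccontr)
      assume "\<not> p n \<le> bot"
      moreover have "g m < g n" using m that(3,4) g_less_iff[of m n] by (force simp: adjacent_def)
      ultimately have "p m = p 0" using surf_eq[of p m n] that(1) cl(2) by auto
      then show False using c[OF that(1)] that(2) by simp
    qed
    then show ?thesis using m c by (intro exI[of _ m] exI[of _ c] conjI disjI2) auto
  next
    \<comment> \<open>Between \<open>k\<close> and any gap to its right lies a further gap
      \<open>j\<close>. A positive coordinate beyond it would put \<open>p j\<close> at full height,
      which is impossible above the common bound \<open>lr_point \<beta>\<close>. So level
      \<open>bot\<close> suffices.\<close>
    case False
    obtain b where b: "\<And>n p. k < g n \<Longrightarrow> p \<in> A \<Longrightarrow> p n \<le> b n" using bdd by metis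
    obtain \<beta> where \<beta>: "\<And>n. b n < lr_point \<beta>" using countable_long_ray_bounded[of "range b"] by auto
    have "p n \<le> bot" if p: "p \<in> A" "lr_point \<beta> < p 0" and n: "k < g n" for p n
    proof (rule ccontr)
      assume "\<not> p n \<le> bot"
      obtain j where j: "k < g j" "g j < g n" using False n by (auto simp: adjacent_def not_le)
      have "p j = p 0" using surf_eq[OF _ j(2)] p(1) cl(2) \<open>\<not> p n \<le> bot\<close> by auto
      then have "p 0 < lr_point \<beta>" using le_less_trans[OF b[OF j(1) p(1)] \<beta>[of j]] by simp
      then show False using p(2) by (rule less_asym)
    qed
    then show ?thesis by (intro exI[of _ 0] exI[of _ bot]) auto
  qed
  then obtain m c b where mc: "c = bot \<or> adjacent k m"
    and b: "\<And>p n. p \<in> A \<Longrightarrow> b < p 0 \<Longrightarrow> k < g n \<Longrightarrow> p n \<le> (if n = m then c else bot)"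
    by blast
  have "\<exists>p\<in>A \<inter> fat_line k m c. a < p 0" for a
  proof -
    obtain p where "p \<in> A" "max a b < p 0" "\<And>n. g n < k \<Longrightarrow> p n = p 0" using full[of "max a b"] by blast
    then show ?thesis using b[of p] by (intro bexI[of _ p]) (auto simp: fat_line_def)
  qed
  moreover have "closed (A \<inter> fat_line k m c)" using cl(1) closed_fat_line by (rule closed_Int)
  ultimately have "surf_club (A \<inter> fat_line k m c)" using cl(2) by (auto simp: surf_club_iff)
  then show ?thesis using mc by blast
qed

text \<open>The part of \<open>A\<close> in a fat line supplies the heights for
  \<open>strip_unbounded\<close>. At such a height \<open>f\<close> equals the height on all strips
  of the fat line, and the point of \<open>A\<close> that supplied it lies on one of them.\<close>

lemma club_unbounded_if_line_unbounded:
  fixes f :: "(nat \<Rightarrow> long_ray) \<Rightarrow> long_ray"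
  assumes A: "surf_club A" and f: "continuous_on surf f"
    and unb: "\<forall>a. \<exists>x. a < f (line (club_index A) x)"
  shows "\<exists>p\<in>A. a < f p"
proof -
  define k where "k = club_index A"
  have k: "k \<in> K" using club_index(1)[OF A] by (simp add: k_def)
  obtain m c where mc: "c = bot \<or> adjacent k m" "surf_club (A \<inter> fat_line k m c)"
    using club_meets_fat_line[OF A] unfolding k_def by blast
  then have cl: "closed (A \<inter> fat_line k m c)" "A \<inter> fat_line k m c \<subseteq> surf"
    "\<And>a. \<exists>p\<in>A \<inter> fat_line k m c. a < p 0" by (auto simp: surf_club_iff)
  obtain p where p: "p \<in> A \<inter> fat_line k m c" "a < p 0" "\<forall>d\<le>c. f (strip k m d (p 0)) = p 0"
    using strip_unbounded[OF k mc(1) f unb[folded k_def] cl] by blast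
  obtain d where "d \<le> c" "p = strip k m d (p 0)"
    using fat_line_strip[OF k, of p m c] p(1) cl(2) by blast
  then have "f p = p 0" using p(3) by metis
  then show ?thesis using p by (intro bexI[of _ p]) auto
qed

text \<open>\<open>f\<close> may be unbounded only on a part of \<open>B\<close> that stays to the
  left of its index. The points where \<open>f\<close> equals the height form a club
  \<open>B0\<close> whose index \<open>k\<close> may be smaller. Were \<open>f\<close> bounded on
  the line at \<open>k\<close>, it would be bounded on a fat line in which \<open>B0\<close> is
  still unbounded. Monotonicity carries the conclusion from \<open>k\<close> to the index of
  \<open>B\<close>.\<close>

lemma line_unbounded_if_club_unbounded:
  fixes f :: "(nat \<Rightarrow> long_ray) \<Rightarrow> long_ray"
  assumes B: "surf_club B" and f: "continuous_on surf f" and unb: "\<And>a. \<exists>p\<in>B. a < f p"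
  shows "\<forall>a. \<exists>x. a < f (line (club_index B) x)"
proof -
  have cl: "closed B" "B \<subseteq> surf" using B by (auto simp: surf_club_iff)
  define B0 where "B0 = {p \<in> B. f p = p 0}"
  have "surf_club B0"
    unfolding surf_club_iff B0_def
    using closed_fixed_height[OF cl f] cl(2) ex_fixed_height[OF cl f unb] by blast
  define k where "k = club_index B0"
  have k: "k \<in> K" using club_index(1)[OF \<open>surf_club B0\<close>] by (simp add: k_def)
  have "unbounded_coordinates B0 \<subseteq> unbounded_coordinates B"
    unfolding unbounded_coordinates_def B0_def by blast
  then have le: "k \<le> club_index B"
    unfolding k_def using \<open>surf_club B0\<close> B by (intro club_index_mono)
  obtain m c where mc: "c = bot \<or> adjacent k m" "surf_club (B0 \<inter> fat_line k m c)"
    using club_meets_fat_line[OF \<open>surf_club B0\<close>] unfolding k_def by blast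
  have "\<forall>a. \<exists>x. a < f (line k x)"
  proof (rule ccontr)
    assume "\<not> ?thesis"
    then obtain b where b: "\<forall>d\<le>c. \<forall>x. f (strip k m d x) \<le> b"
      using strip_bounded[OF k mc(1) f] by blast
    obtain p where p: "p \<in> B0 \<inter> fat_line k m c" "b < p 0"
      using mc(2) unfolding surf_club_iff by blast
    then obtain d where "d \<le> c" "p = strip k m d (p 0)"
      using fat_line_strip[OF k, of p m c] cl(2) by (auto simp: B0_def)
    then have "f p \<le> b" using b by metis
    then show False using p by (simp add: B0_def)
  qed
  then show ?thesis
    using line_unbounded_mono[OF k club_index(1)[OF B] le f] by blast
qed

text \<open>In one direction the gap coordinates are the test functions. In the other, unboundedness
  goes from \<open>A\<close> to the line at its index, along \<open>K\<close> to the line at the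
  index of \<open>B\<close>, and from there to \<open>B\<close>. As this covers all clubs, a
  direction is just a club whose subclubs all keep its index.\<close>

lemma ufo_le_iff_club_index:
  assumes A: "surf_club A" and B: "surf_club B"
  shows "ufo_le (top_of_set surf) A B \<longleftrightarrow> club_index A \<le> club_index B"
proof
  assume le: "ufo_le (top_of_set surf) A B"
  have "n \<in> unbounded_coordinates B" if n: "n \<in> unbounded_coordinates A" for n
  proof -
    have "continuous_map (top_of_set surf) euclidean (\<lambda>p :: nat \<Rightarrow> long_ray. p n)"
      by (simp add: continuous_on_coordinate)
    moreover have "unbounded_wrt lr_exhaustion ((\<lambda>p. p n) ` A)"
      using n unfolding unbounded_lr_exhaustion_iff by (simp add: unbounded_coordinates_def)
    ultimately have "unbounded_wrt lr_exhaustion ((\<lambda>p. p n) ` B)"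
      using le unfolding ufo_le_def by blast
    then show ?thesis
      unfolding unbounded_lr_exhaustion_iff by (simp add: unbounded_coordinates_def)
  qed
  then show "club_index A \<le> club_index B" by (intro club_index_mono A B) blast
next
  assume le: "club_index A \<le> club_index B"
  show "ufo_le (top_of_set surf) A B"
    unfolding ufo_le_def
  proof (intro allI impI)
    fix f :: "(nat \<Rightarrow> long_ray) \<Rightarrow> long_ray"
    assume "continuous_map (top_of_set surf) euclidean f"
      and unb: "unbounded_wrt lr_exhaustion (f ` A)"
    then have f: "continuous_on surf f" by simp
    have "\<exists>p\<in>A. a < f p" for a using unb unfolding unbounded_lr_exhaustion_iff by simp
    then have "\<forall>a. \<exists>x. a < f (line (club_index A) x)"
      by (rule line_unbounded_if_club_unbounded[OF A f])
    then have "\<forall>a. \<exists>x. a < f (line (club_index B) x)"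
      by (rule line_unbounded_mono[OF club_index(1)[OF A] club_index(1)[OF B] le f])
    then show "unbounded_wrt lr_exhaustion (f ` B)"
      unfolding unbounded_lr_exhaustion_iff
      using club_unbounded_if_line_unbounded[OF B f] by simp
  qed
qed

abbreviation surf_direction :: "(nat \<Rightarrow> long_ray) set \<Rightarrow> bool" where
  "surf_direction \<equiv> direction (top_of_set surf) exhaustion"

lemma surf_direction_club: "surf_direction D \<Longrightarrow> surf_club D"
  by (simp add: direction_def)

lemma ufo_equiv_iff_club_index:
  "surf_club A \<Longrightarrow> surf_club B \<Longrightarrow> ufo_equiv (top_of_set surf) A B \<longleftrightarrow> club_index A = club_index B"
  by (auto simp: ufo_equiv_def ufo_le_iff_club_index)

text \<open>The line at \<open>k\<close> serves: its points are determined by their heights, so all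
  its subclubs have the same unbounded coordinates.\<close>

lemma ex_direction_with_index:
  assumes k: "k \<in> K"
  shows "\<exists>D. surf_direction D \<and> club_index D = k"
proof -
  define D where "D = surf \<inter> fat_line k 0 bot"
  have D_line: "p = line k (p 0)" if "p \<in> D" for p
    using fat_line_strip[OF k, of p 0 bot] that by (auto simp: D_def bot.extremum_unique)
  have line_D: "line k x \<in> D" for x
    using strip_0[OF k] line_in_surf[OF k] not_g_less_iff[OF k]
    by (auto simp: D_def fat_line_def strip_def)
  have "\<exists>p\<in>D. a < p 0" for a
    using ex_lr_point_greater[of a] line_D strip_0[OF k, of 0 bot] by metis
  then have club: "surf_club D"
    by (auto simp: surf_club_iff D_def closed_surf closed_fat_line intro: closed_Int)
  have idx: "club_index C = k" if C: "surf_club C" "C \<subseteq> D" for C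
  proof -
    have "n \<in> unbounded_coordinates C \<longleftrightarrow> g n < k" for n
    proof
      assume "n \<in> unbounded_coordinates C"
      then obtain p where "p \<in> C" "bot < p n" unfolding unbounded_coordinates_def by blast
      moreover have "p n = line k (p 0) n" using D_line[of p] C(2) \<open>p \<in> C\<close> by auto
      ultimately show "g n < k" by (auto simp: strip_def split: if_splits)
    next
      assume n: "g n < k"
      have eq: "p n = p 0" if "p \<in> C" for p
      proof -
        have "p n = line k (p 0) n" using D_line[of p] C(2) that by auto
        then show ?thesis using n by (simp add: strip_def)
      qed
      have "\<forall>a. \<exists>p\<in>C. a < p 0" using C(1) by (simp add: surf_club_iff)
      then show "n \<in> unbounded_coordinates C"
        by (simp add: unbounded_coordinates_def eq cong: bex_cong)
    qed
    then have "k \<in> K \<and> unbounded_coordinates C = {n. g n < k}" using k by blast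
    then show ?thesis
      using unbounded_coordinates_eq[OF C(1)] club_index[OF C(1)] by blast
  qed
  have "surf_direction D"
    unfolding direction_def using club idx ufo_equiv_iff_club_index by auto
  then show ?thesis using idx[OF club order_refl] by blast
qed

theorem direction_classes_order_iso:
  "\<exists>\<phi>. bij_betw \<phi> (direction_classes (top_of_set surf) exhaustion) K \<and>
    (\<forall>\<A>\<in>direction_classes (top_of_set surf) exhaustion. \<forall>\<B>\<in>direction_classes (top_of_set surf) exhaustion.
      class_le (top_of_set surf) \<A> \<B> \<longleftrightarrow> \<phi> \<A> \<le> \<phi> \<B>)"
proof -
  define cls where "cls D = {B. surf_direction B \<and> club_index B = club_index D}" for D
  have "{(A, B). surf_direction A \<and> surf_direction B \<and> ufo_equiv (top_of_set surf) A B} `` {D} = cls D"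
    if "surf_direction D" for D
    using that ufo_equiv_iff_club_index surf_direction_club by (auto simp: cls_def)
  then have classes: "direction_classes (top_of_set surf) exhaustion = cls ` {D. surf_direction D}"
    by (auto simp: direction_classes_def quotient_def)
  \<comment> \<open>Well defined, since all members of a class have the same index.\<close>
  define \<phi> where "\<phi> \<A> = club_index (SOME D. D \<in> \<A>)" for \<A>
  have \<phi>: "\<phi> (cls D) = club_index D" if "surf_direction D" for D
  proof -
    have "D \<in> cls D" using that by (simp add: cls_def)
    then have "(SOME D'. D' \<in> cls D) \<in> cls D" by (rule someI)
    then show ?thesis by (simp add: \<phi>_def cls_def)
  qed
  have "bij_betw \<phi> (cls ` {D. surf_direction D}) K"
    unfolding bij_betw_def
  proof
    show "inj_on \<phi> (cls ` {D. surf_direction D})"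
    proof (rule inj_onI)
      fix \<A> \<B>
      assume "\<A> \<in> cls ` {D. surf_direction D}" "\<B> \<in> cls ` {D. surf_direction D}" and eq: "\<phi> \<A> = \<phi> \<B>"
      then obtain A B where "\<A> = cls A" "\<B> = cls B" "surf_direction A" "surf_direction B" by blast
      with eq show "\<A> = \<B>" using \<phi>[of A] \<phi>[of B] by (simp add: cls_def)
    qed
    show "\<phi> ` cls ` {D. surf_direction D} = K"
    proof (intro equalityI subsetI)
      fix k assume "k \<in> \<phi> ` cls ` {D. surf_direction D}"
      then show "k \<in> K" using \<phi> club_index(1) surf_direction_club by auto
    next
      fix k assume "k \<in> K"
      then obtain D where "surf_direction D" "club_index D = k" using ex_direction_with_index by blast
      then show "k \<in> \<phi> ` cls ` {D. surf_direction D}"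
        using \<phi> by (intro image_eqI[of _ _ "cls D"]) auto
    qed
  qed
  moreover have "class_le (top_of_set surf) (cls A) (cls B) \<longleftrightarrow> \<phi> (cls A) \<le> \<phi> (cls B)"
    if AB: "surf_direction A" "surf_direction B" for A B
  proof
    assume "class_le (top_of_set surf) (cls A) (cls B)"
    then obtain A' B' where *: "A' \<in> cls A" "B' \<in> cls B" "ufo_le (top_of_set surf) A' B'"
      unfolding class_le_def by blast
    then have "surf_club A'" "surf_club B'" by (simp_all add: cls_def surf_direction_club)
    then have "club_index A' \<le> club_index B'" using *(3) by (simp add: ufo_le_iff_club_index)
    then show "\<phi> (cls A) \<le> \<phi> (cls B)"
      unfolding \<phi>[OF AB(1)] \<phi>[OF AB(2)] using *(1,2) by (simp add: cls_def)
  next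
    assume "\<phi> (cls A) \<le> \<phi> (cls B)"
    then have "ufo_le (top_of_set surf) A B"
      using ufo_le_iff_club_index surf_direction_club AB by (simp add: \<phi>)
    moreover have "A \<in> cls A" "B \<in> cls B" using AB by (simp_all add: cls_def)
    ultimately show "class_le (top_of_set surf) (cls A) (cls B)" unfolding class_le_def by blast
  qed
  ultimately show ?thesis unfolding classes by blast
qed

end

(* The carrier type nat => long_ray has the cardinality of the continuum, which bounds the
   cardinality of every connected Hausdorff manifold, so every surface has a copy on it. *)
theorem mainTheorem17:
  shows "\<exists>(S :: (nat \<Rightarrow> long_ray) topology) (U :: omega1 \<Rightarrow> (nat \<Rightarrow> long_ray) set).
     surface S \<and> omega_bounded S \<and> type_I_space S U \<and>
     (\<exists>\<phi>. bij_betw \<phi> (direction_classes S U) cantor_set \<and>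
          (\<forall>\<A>\<in>direction_classes S U. \<forall>\<B>\<in>direction_classes S U.
             class_le S \<A> \<B> \<longleftrightarrow> \<phi> \<A> \<le> \<phi> \<B>))"
proof -
  obtain g where "gap_enumeration cantor_set g"
    using ex_gap_enumeration[OF compact_cantor_set infinite_cantor_set cantor_set_no_interval] by blast
  then interpret gap_enumeration cantor_set g .
  show ?thesis
    using surface_surf omega_bounded_surf type_I_space_surf direction_classes_order_iso by blast
qed

end
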